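(* Let $G$ be a cactus graph containing $t\ge1$ cycles $C_1,\dots,C_t$, where $C_i$ has length $n_i$, let $\mathbb{k}$ be a field and $S=\mathbb{k}[x_1,\dots,x_{|E_G|}]$. Let $\sigma_j$ be the $j$-th elementary symmetric polynomial in $n_1,\dots,n_t$, i.e. $\sigma_0=1$ and $\sigma_j=\sum_{1\le k_1<\cdots<k_j\le t}n_{k_1}\cdots n_{k_j}$ for $1\le j\le t$. Then the facet ideal of $M(G)$ has ungraded minimal free resolution \[0\leftarrow S^{\beta_0}\leftarrow S^{\beta_1}\leftarrow\cdots\leftarrow S^{\beta_t}\leftarrow 0,\qquad \beta_i=\sum_{j=0}^i(-1)^j\binom{t-j}{i-j}\sigma_{t-j}.\]
   Context: A cactus graph is a finite connected graph each of whose blocks is either a cycle or a single edge. $E_G$ is the edge set of $G$, identified with $\{1,\dots,|E_G|\}$; $M(G)$ is the cycle matroid of $G$. The facet ideal $\mathcal{F}(N)$ of a matroid $N$ on $\{1,\dots,n\}$ is the ideal of $\mathbb{k}[x_1,\dots,x_n]$ generated by $\prod_{j\in\sigma}x_j$ for $\sigma$ a basis of $N$. An ungraded minimal free resolution is an exact (except in degree $0$) free complex resolving the module whose maps have image in $\mathfrak{m}$ times the target, $\mathfrak{m}=\langle x_1,\dots,x_n\rangle$. *)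

theory Defs
  imports
    "HOL-Library.Poly_Mapping"
    "HOL-Algebra.Ideal"
    "Jordan_Normal_Form.Matrix"
begin

section \<open>Undirected graphs\<close>

text \<open>
  Parallel edges and loops are permitted. An edge has the one- or two-element set
  of its end vertices attached to it, a loop being an edge with a single end vertex.
  Simple graphs are the case in which the attachment is injective with values of cardinality two.
\<close>

record ('v, 'e) graph =
  verts :: "'v set"
  edges :: "'e set"
  ends :: "'e \<Rightarrow> 'v set"

definition finite_graph :: "('v, 'e) graph \<Rightarrow> bool" where
  "finite_graph G \<longleftrightarrow> finite (verts G) \<and> finite (edges G) \<and>
     (\<forall>e\<in>edges G. ends G e \<subseteq> verts G \<and> card (ends G e) \<in> {1, 2})"

text \<open>
  A subgraph inherits the whole attachment function, so that it is determined by its vertex set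
  and its edge set.
\<close>

definition subgraph :: "('v, 'e) graph \<Rightarrow> ('v, 'e) graph \<Rightarrow> bool" where
  "subgraph H G \<longleftrightarrow> finite_graph H \<and> verts H \<subseteq> verts G \<and> edges H \<subseteq> edges G \<and> ends H = ends G"

definition connected_graph :: "('v, 'e) graph \<Rightarrow> bool" where
  "connected_graph G \<longleftrightarrow> verts G \<noteq> {} \<and>
     (\<forall>u\<in>verts G. \<forall>v\<in>verts G. (u, v) \<in> {(a, b). \<exists>e\<in>edges G. ends G e = {a, b}}\<^sup>*)"

text \<open>
  A separation is a decomposition into two connected subgraphs, each with at least one edge, that
  have exactly one vertex in common. For loopless graphs this is the same as the
  existence of a cut vertex; phrased in this way, a loop forms a block of its own.
\<close>

definition separable :: "('v, 'e) graph \<Rightarrow> bool" where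
  "separable G \<longleftrightarrow> (\<exists>H\<^sub>1 H\<^sub>2 v. subgraph H\<^sub>1 G \<and> subgraph H\<^sub>2 G \<and>
     connected_graph H\<^sub>1 \<and> connected_graph H\<^sub>2 \<and> edges H\<^sub>1 \<noteq> {} \<and> edges H\<^sub>2 \<noteq> {} \<and>
     edges H\<^sub>1 \<union> edges H\<^sub>2 = edges G \<and> edges H\<^sub>1 \<inter> edges H\<^sub>2 = {} \<and>
     verts H\<^sub>1 \<union> verts H\<^sub>2 = verts G \<and> verts H\<^sub>1 \<inter> verts H\<^sub>2 = {v})"

definition nonseparable :: "('v, 'e) graph \<Rightarrow> bool" where
  "nonseparable G \<longleftrightarrow> connected_graph G \<and> \<not> separable G"

definition block :: "('v, 'e) graph \<Rightarrow> ('v, 'e) graph \<Rightarrow> bool" where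
  "block B G \<longleftrightarrow> subgraph B G \<and> nonseparable B \<and>
     (\<forall>H. subgraph H G \<and> nonseparable H \<and> subgraph B H \<longrightarrow> H = B)"

text \<open>
  The vertices and edges of a cycle of length \<open>n\<close> are listed in cyclic order. For \<open>n = 1\<close> this is a
  loop, for \<open>n = 2\<close> a pair of parallel edges.
\<close>

definition cycle_of_length :: "nat \<Rightarrow> ('v, 'e) graph \<Rightarrow> bool" where
  "cycle_of_length n H \<longleftrightarrow> n \<ge> 1 \<and>
     (\<exists>vs es. length vs = n \<and> length es = n \<and> distinct vs \<and> distinct es \<and>
        verts H = set vs \<and> edges H = set es \<and>
        (\<forall>i<n. ends H (es ! i) = {vs ! i, vs ! ((i + 1) mod n)}))"

definition is_cycle :: "('v, 'e) graph \<Rightarrow> bool" where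
  "is_cycle H \<longleftrightarrow> (\<exists>n. cycle_of_length n H)"

definition is_single_edge :: "('v, 'e) graph \<Rightarrow> bool" where
  "is_single_edge H \<longleftrightarrow>
     (\<exists>e u v. u \<noteq> v \<and> verts H = {u, v} \<and> edges H = {e} \<and> ends H e = {u, v})"

definition cactus :: "('v, 'e) graph \<Rightarrow> bool" where
  "cactus G \<longleftrightarrow> finite_graph G \<and> connected_graph G \<and>
     (\<forall>B. block B G \<longrightarrow> is_cycle B \<or> is_single_edge B)"


section \<open>Cycle matroids\<close>

text \<open>
  A matroid is given by its ground set and its independent sets; the matroid axioms
  are not part of the type. A set of edges is independent in the cycle matroid if and only if it
  does not contain the edge set of a cycle.
\<close>

record 'e matroid =
  ground :: "'e set"
  indep :: "'e set \<Rightarrow> bool"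

definition cycle_matroid :: "('v, 'e) graph \<Rightarrow> 'e matroid" where
  "cycle_matroid G = \<lparr>ground = edges G,
     indep = (\<lambda>X. X \<subseteq> edges G \<and> \<not> (\<exists>H. subgraph H G \<and> is_cycle H \<and> edges H \<subseteq> X))\<rparr>"

definition matroid_basis :: "'e matroid \<Rightarrow> 'e set \<Rightarrow> bool" where
  "matroid_basis N B \<longleftrightarrow> indep N B \<and> (\<forall>X. indep N X \<and> B \<subseteq> X \<longrightarrow> X = B)"


section \<open>Polynomial rings and facet ideals\<close>

type_synonym ('e, 'k) mpoly = "('e \<Rightarrow>\<^sub>0 nat) \<Rightarrow>\<^sub>0 'k"

definition indet :: "'e \<Rightarrow> ('e, 'k::field) mpoly" where
  "indet e = Poly_Mapping.single (Poly_Mapping.single e 1) 1"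

text \<open>
  The elements of \<^typ>\<open>('e, 'k) mpoly\<close> are the polynomials in all indeterminates indexed by
  \<^typ>\<open>'e\<close>. The ring \<open>poly_ring E\<close> consists of those in which only indeterminates indexed by \<open>E\<close>
  occur; its operations are the ones of the type.
\<close>

definition poly_ring :: "'e set \<Rightarrow> ('e, 'k::field) mpoly ring" where
  "poly_ring E = \<lparr>carrier = {p. \<forall>m\<in>Poly_Mapping.keys p. Poly_Mapping.keys m \<subseteq> E},
     monoid.mult = (*), one = 1, ring.zero = 0, add = (+)\<rparr>"

definition facet_ideal :: "'e matroid \<Rightarrow> ('e, 'k::field) mpoly set" where
  "facet_ideal N = Idl\<^bsub>poly_ring (ground N)\<^esub> {\<Prod>j\<in>B. indet j |B. matroid_basis N B}"

definition max_ideal :: "'e set \<Rightarrow> ('e, 'k::field) mpoly set" where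
  "max_ideal E = Idl\<^bsub>poly_ring E\<^esub> (indet ` E)"


section \<open>Free resolutions\<close>

text \<open>
  With \<open>S = poly_ring E\<close>, the free module \<open>S\<^sup>b\<close> consists of the vectors of dimension \<open>b\<close> with
  entries in \<open>S\<close>, and the \<open>S\<close>-linear maps from \<open>S\<^sup>c\<close> to \<open>S\<^sup>r\<close> are given by the \<open>r\<close> by \<open>c\<close> matrices
  over \<open>S\<close>.
\<close>

definition free_module :: "'e set \<Rightarrow> nat \<Rightarrow> ('e, 'k::field) mpoly vec set" where
  "free_module E b = {v \<in> carrier_vec b. \<forall>i<b. v $ i \<in> carrier (poly_ring E)}"

definition free_map :: "'e set \<Rightarrow> nat \<Rightarrow> nat \<Rightarrow> ('e, 'k::field) mpoly mat set" where
  "free_map E r c = {A \<in> carrier_mat r c. elements_mat A \<subseteq> carrier (poly_ring E)}"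

text \<open>The submodule \<open>I S\<^sup>b\<close> generated by the products of elements of \<open>I\<close> with elements of \<open>S\<^sup>b\<close>:\<close>

inductive_set ideal_times_free ::
    "'e set \<Rightarrow> ('e, 'k::field) mpoly set \<Rightarrow> nat \<Rightarrow> ('e, 'k) mpoly vec set"
  for E I b where
  zero: "0\<^sub>v b \<in> ideal_times_free E I b"
| add: "a \<in> I \<Longrightarrow> w \<in> free_module E b \<Longrightarrow> u \<in> ideal_times_free E I b \<Longrightarrow>
    a \<cdot>\<^sub>v w + u \<in> ideal_times_free E I b"

text \<open>
  A resolution of an ideal \<open>I\<close> of \<open>S\<close> by free modules of finite rank,
  \<open>0 \<leftarrow> I \<leftarrow> S\<^sup>\<beta>\<^sup>0 \<leftarrow> S\<^sup>\<beta>\<^sup>1 \<leftarrow> \<dots>\<close>. The augmentation, a linear map from the free module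
  of rank \<open>\<beta> 0\<close> to \<open>S\<close> with image \<open>I\<close>, is given by the vector \<open>\<epsilon>\<close> of the images of the unit
  vectors; \<open>d i\<close> maps the free module of rank \<open>\<beta> (Suc i)\<close> to the one of rank \<open>\<beta> i\<close>.
  Exactness includes that consecutive maps compose to zero. A finite resolution of length at most
  \<open>t\<close> is one with \<open>\<beta> i = 0\<close> for all \<open>i > t\<close>.
\<close>

definition free_resolution ::
    "'e set \<Rightarrow> ('e, 'k::field) mpoly set \<Rightarrow> (nat \<Rightarrow> nat) \<Rightarrow>
     ('e, 'k) mpoly vec \<Rightarrow> (nat \<Rightarrow> ('e, 'k) mpoly mat) \<Rightarrow> bool" where
  "free_resolution E I \<beta> \<epsilon> d \<longleftrightarrow>
     \<epsilon> \<in> free_module E (\<beta> 0) \<and>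
     (\<forall>i. d i \<in> free_map E (\<beta> i) (\<beta> (Suc i))) \<and>
     (\<lambda>v. v \<bullet> \<epsilon>) ` free_module E (\<beta> 0) = I \<and>
     {v \<in> free_module E (\<beta> 0). v \<bullet> \<epsilon> = 0} = (*\<^sub>v) (d 0) ` free_module E (\<beta> 1) \<and>
     (\<forall>i. {v \<in> free_module E (\<beta> (Suc i)). d i *\<^sub>v v = 0\<^sub>v (\<beta> i)} =
            (*\<^sub>v) (d (Suc i)) ` free_module E (\<beta> (Suc (Suc i))))"

definition minimal_free_resolution ::
    "'e set \<Rightarrow> ('e, 'k::field) mpoly set \<Rightarrow> (nat \<Rightarrow> nat) \<Rightarrow>
     ('e, 'k) mpoly vec \<Rightarrow> (nat \<Rightarrow> ('e, 'k) mpoly mat) \<Rightarrow> bool" where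
  "minimal_free_resolution E I \<beta> \<epsilon> d \<longleftrightarrow> free_resolution E I \<beta> \<epsilon> d \<and>
     (\<forall>i. (*\<^sub>v) (d i) ` free_module E (\<beta> (Suc i)) \<subseteq> ideal_times_free E (max_ideal E) (\<beta> i))"


section \<open>Elementary symmetric polynomials\<close>

definition elem_sym :: "(nat \<Rightarrow> nat) \<Rightarrow> nat \<Rightarrow> nat \<Rightarrow> nat" where
  "elem_sym n t j = (\<Sum>A\<in>{A. A \<subseteq> {1..t} \<and> card A = j}. \<Prod>k\<in>A. n k)"

end

theory Submission
  imports Defs "HOL-Computational_Algebra.Polynomial"
begin

text \<open>
  In a cactus graph two cycles with a common edge coincide: their union is nonseparable, hence lies
  in a block, which is a cycle and contains no other cycle. So a basis arises by deleting one edge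
  from each of the disjoint cycles, and the facet ideal is a product of a monomial and of ideals
  \<open>I\<^sub>1, \<dots>, I\<^sub>t\<close> in disjoint sets of indeterminates, where \<open>I\<^sub>k\<close> is generated by the \<open>n\<^sub>k\<close> products of
  all but one edge of the \<open>k\<close>-th cycle. Each \<open>I\<^sub>k\<close> has a Hilbert--Burch resolution with ranks \<open>n\<^sub>k\<close> and
  \<open>n\<^sub>k - 1\<close>. The tensor product of these resolutions, an iterated mapping cone, resolves the facet
  ideal, and its ranks are the coefficients of
  \<open>\<Prod>\<^sub>k (n\<^sub>k + (n\<^sub>k - 1) x) = \<Prod>\<^sub>k (n\<^sub>k (1 + x) - x)\<close>.
\<close>

section \<open>Polynomials in many indeterminates\<close>

text \<open>Exactness of a tensor product of resolutions of ideals in disjoint indeterminates is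
  classically a vanishing statement for Tor. Here it becomes an induction on the cycles that rests
  on two properties of an indeterminate \<open>x\<close> of the first cycle. It is not a zero
  divisor; this passes from a relation multiplied by \<open>x\<close> to the relation itself when a
  syzygy coordinate has degree zero. And division by \<open>x\<close> can be done coefficientwise on
  chains of the remaining cycles, because their monomials do not involve \<open>x\<close>; this
  lifts quotients of augmentations back to chains. The Hilbert--Burch matrix compares every edge of
  a cycle with one fixed edge: the product of all edges but \<open>e\<close>, multiplied by the
  indeterminate of \<open>e\<close>, is the same monomial for every \<open>e\<close>. A loop fits in
  as the case of one generator, the empty product, and no syzygy. In the rank formula
  \<open>j\<close> is the number of factors of the generating function from which the summand
  \<open>-x\<close> is taken, which explains both the sign and the index
  \<open>t - j\<close>.\<close>

lemma mpoly_induct [case_names zero single add]: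
  fixes f :: "('e, 'k::field) mpoly"
  assumes "P 0" "\<And>m c. P (Poly_Mapping.single m c)" "\<And>f g. P f \<Longrightarrow> P g \<Longrightarrow> P (f + g)"
  shows "P f"
proof (induction f rule: update_induct)
  case const
  then show ?case by (rule assms(1))
next
  case (update f a b)
  have "Poly_Mapping.update a b f = f + Poly_Mapping.single a b"
    using update(1)
    by (intro poly_mapping_eqI)
      (auto simp: lookup_update lookup_add lookup_single when_def in_keys_iff)
  then show ?case using assms(2,3) update by simp
qed

text \<open>
  Division by an indeterminate discards the monomials in which it does not occur. It is linear
  over the polynomials without that indeterminate, which replaces all appeals to unique
  factorisation.
\<close>

definition div_indet :: "'e \<Rightarrow> ('e, 'k::field) mpoly \<Rightarrow> ('e, 'k) mpoly" where
  "div_indet x f = Poly_Mapping.map_key (\<lambda>m. m + Poly_Mapping.single x 1) f"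

lemma inj_add_single: "inj (\<lambda>m::'e \<Rightarrow>\<^sub>0 nat. m + Poly_Mapping.single x 1)"
  by (simp add: inj_def)

lemma div_indet_add: "div_indet x (f + g) = div_indet x f + div_indet x g"
  unfolding div_indet_def by (rule map_key_plus [OF inj_add_single])

lemma div_indet_zero [simp]: "div_indet x 0 = 0"
  unfolding div_indet_def by (rule map_key_zero [OF inj_add_single])

lemma div_indet_sum: "div_indet x (sum f A) = (\<Sum>a\<in>A. div_indet x (f a))"
  by (induction A rule: infinite_finite_induct) (auto simp: div_indet_add)

lemma lookup_div_indet:
  "Poly_Mapping.lookup (div_indet x f) m = Poly_Mapping.lookup f (m + Poly_Mapping.single x 1)"
  unfolding div_indet_def by (simp add: map_key.rep_eq [OF inj_add_single] del: One_nat_def)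

lemma div_indet_single:
  "div_indet x (Poly_Mapping.single m c) =
     (if Poly_Mapping.lookup m x = 0 then 0
      else Poly_Mapping.single (m - Poly_Mapping.single x 1) c)"
proof (cases "Poly_Mapping.lookup m x = 0")
  case True
  have "m \<noteq> m' + Poly_Mapping.single x 1" for m'
  proof
    assume "m = m' + Poly_Mapping.single x 1"
    then have "Poly_Mapping.lookup m x = Poly_Mapping.lookup m' x + 1"
      by (simp add: lookup_add)
    then show False using True by simp
  qed
  then show ?thesis using True
    by (intro poly_mapping_eqI) (auto simp: lookup_div_indet lookup_single when_def)
next
  case False
  define m' where "m' = m - Poly_Mapping.single x 1"
  have "m = m' + Poly_Mapping.single x 1"
    unfolding m'_def using False
    by (intro poly_mapping_eqI) (auto simp: lookup_add lookup_minus lookup_single when_def)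
  then show ?thesis using False
    by (metis div_indet_def m'_def map_key_single [OF inj_add_single])
qed

lemma div_indet_mult: "div_indet x (indet x * f) = f"
proof (induction f rule: mpoly_induct)
  case (single m c)
  then show ?case
    by (simp add: indet_def mult_single div_indet_single lookup_add)
next
  case (add f g)
  then show ?case by (simp add: distrib_left div_indet_add)
qed simp

text \<open>Multiplication by another indeterminate leaves the exponent of \<open>x\<close> alone,
  so the same monomials are discarded before and after it.\<close>

lemma div_indet_mult_other:
  assumes "x \<noteq> y"
  shows "div_indet x (f * indet y) = div_indet x f * indet y"
proof (induction f rule: mpoly_induct)
  case (single m c)
  have "m + Poly_Mapping.single y 1 - Poly_Mapping.single x 1 =
      m - Poly_Mapping.single x 1 + Poly_Mapping.single y (1::nat)"
    using assms
    by (intro poly_mapping_eqI) (auto simp: lookup_add lookup_minus lookup_single when_def)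
  then show ?case using assms
    by (simp add: indet_def mult_single div_indet_single lookup_add lookup_single when_def)
next
  case (add f g)
  then show ?case by (simp add: distrib_right div_indet_add)
qed simp

lemma div_indet_mult_prod:
  assumes "finite B" "x \<notin> B"
  shows "div_indet x (f * (\<Prod>j\<in>B. indet j)) = div_indet x f * (\<Prod>j\<in>B. indet j)"
  using assms
proof (induction B arbitrary: f rule: finite_induct)
  case (insert b B)
  have "div_indet x (f * indet b * (\<Prod>j\<in>B. indet j)) = div_indet x f * indet b * (\<Prod>j\<in>B. indet j)"
    using insert by (simp add: div_indet_mult_other)
  then show ?case using insert by (simp add: mult.assoc)
qed simp

text \<open>Since \<open>div_indet x\<close> undoes multiplication by \<open>indet x\<close>, an
  indeterminate is not a zero divisor.\<close>

lemma indet_mult_eq_0: "indet x * f = 0 \<longleftrightarrow> f = 0"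
  by (metis div_indet_mult div_indet_zero mult_zero_right)

lemma prod_indet_mult_eq_0:
  "finite B \<Longrightarrow> (\<Prod>j\<in>B. indet j) * f = 0 \<longleftrightarrow> f = 0"
  by (induction B arbitrary: f rule: finite_induct) (auto simp: mult.assoc indet_mult_eq_0)

lemma mult_prod_indet_eq_0:
  "finite B \<Longrightarrow> f * (\<Prod>j\<in>B. indet j) = 0 \<longleftrightarrow> f = 0"
  using prod_indet_mult_eq_0 [of B f] by (simp add: mult.commute)

section \<open>The subring of polynomials in the indeterminates of a set, and its ideals\<close>

abbreviation polys :: "'e set \<Rightarrow> ('e, 'k::field) mpoly set" where
  "polys E \<equiv> carrier (poly_ring E)"

lemma polys_iff: "p \<in> polys E \<longleftrightarrow> (\<forall>m\<in>Poly_Mapping.keys p. Poly_Mapping.keys m \<subseteq> E)"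
  by (simp add: poly_ring_def)

lemma polys_zero [simp]: "0 \<in> polys E"
  and polys_one [simp]: "1 \<in> polys E"
  by (auto simp: polys_iff)

lemma polys_add: "p \<in> polys E \<Longrightarrow> q \<in> polys E \<Longrightarrow> p + q \<in> polys E"
  unfolding polys_iff using keys_add [of p q] by blast

lemma polys_uminus: "p \<in> polys E \<Longrightarrow> - p \<in> polys (E :: 'e set)"
  for p :: "('e, 'k::field) mpoly"
  by (auto simp: polys_iff in_keys_iff)

lemma polys_mult: "p \<in> polys E \<Longrightarrow> q \<in> polys E \<Longrightarrow> p * q \<in> polys E"
  unfolding polys_iff
  by (auto simp: subset_iff dest!: set_mp [OF keys_mult] set_mp [OF keys_add])

lemma polys_diff: "p \<in> polys E \<Longrightarrow> q \<in> polys E \<Longrightarrow> p - q \<in> polys (E :: 'e set)"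
  for p q :: "('e, 'k::field) mpoly"
  using polys_add [of p E "- q"] polys_uminus [of q E] by simp

lemma polys_sum: "(\<And>a. a \<in> A \<Longrightarrow> f a \<in> polys E) \<Longrightarrow> sum f A \<in> polys E"
  by (induction A rule: infinite_finite_induct) (auto simp: polys_add)

lemma polys_prod: "(\<And>a. a \<in> A \<Longrightarrow> f a \<in> polys E) \<Longrightarrow> prod f A \<in> polys E"
  by (induction A rule: infinite_finite_induct) (auto simp: polys_mult)

lemma polys_indet: "e \<in> E \<Longrightarrow> indet e \<in> polys E"
  by (simp add: polys_iff indet_def)

text \<open>Every monomial of the quotient divides a monomial of \<open>p\<close>, so no new
  indeterminates appear.\<close>

lemma polys_div_indet: "p \<in> polys E \<Longrightarrow> div_indet x p \<in> polys E"
proof -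
  assume p: "p \<in> polys E"
  have "Poly_Mapping.keys m \<subseteq> E" if "m \<in> Poly_Mapping.keys (div_indet x p)" for m
  proof -
    have "m + Poly_Mapping.single x 1 \<in> Poly_Mapping.keys p"
      using that by (simp add: in_keys_iff lookup_div_indet)
    then have "Poly_Mapping.keys (m + Poly_Mapping.single x 1) \<subseteq> E"
      using p by (simp add: polys_iff)
    then show ?thesis by (force simp: subset_iff in_keys_iff lookup_add)
  qed
  then show ?thesis by (simp add: polys_iff)
qed

lemma poly_ring_simps:
  "x \<oplus>\<^bsub>poly_ring E\<^esub> y = x + y" "x \<otimes>\<^bsub>poly_ring E\<^esub> y = x * y"
  "\<zero>\<^bsub>poly_ring E\<^esub> = 0" "\<one>\<^bsub>poly_ring E\<^esub> = 1"
  by (simp_all add: poly_ring_def)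

lemma cring_poly_ring: "cring (poly_ring E :: ('e, 'k::field) mpoly ring)"
proof (rule cringI)
  show "abelian_group (poly_ring E :: ('e, 'k) mpoly ring)"
  proof (rule abelian_groupI)
    fix x :: "('e, 'k) mpoly" assume "x \<in> polys E"
    then show "\<exists>y\<in>polys E. y \<oplus>\<^bsub>poly_ring E\<^esub> x = \<zero>\<^bsub>poly_ring E\<^esub>"
      by (intro bexI [of _ "- x"] polys_uminus) (simp_all add: poly_ring_simps)
  qed (auto simp: poly_ring_simps polys_add ac_simps)
  show "comm_monoid (poly_ring E :: ('e, 'k) mpoly ring)"
    by unfold_locales (auto simp: poly_ring_simps polys_mult ac_simps)
qed (auto simp: poly_ring_simps distrib_right)

text \<open>Closure under negation comes from multiplication by \<open>- 1\<close>, so elementwise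
  conditions in the operations of the type capture the ideals.\<close>

lemma ideal_poly_ring_iff:
  "ideal I (poly_ring E :: ('e, 'k::field) mpoly ring) \<longleftrightarrow>
     I \<subseteq> polys E \<and> 0 \<in> I \<and> (\<forall>a\<in>I. \<forall>b\<in>I. a + b \<in> I) \<and> (\<forall>a\<in>I. \<forall>r\<in>polys E. r * a \<in> I)"
    (is "?L \<longleftrightarrow> ?R")
proof
  assume ?L
  then interpret ideal I "poly_ring E" .
  show ?R
    using a_subset additive_subgroup.zero_closed [OF is_additive_subgroup]
      additive_subgroup.a_closed [OF is_additive_subgroup] I_l_closed
    by (auto simp: poly_ring_simps)
next
  assume R: ?R
  interpret cring "poly_ring E :: ('e, 'k) mpoly ring" by (rule cring_poly_ring)
  show ?L
  proof (rule idealI)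
    show "ring (poly_ring E :: ('e, 'k) mpoly ring)" by (rule ring_axioms)
    have inv: "\<ominus>\<^bsub>poly_ring E\<^esub> x = - x" if "x \<in> polys E" for x :: "('e, 'k) mpoly"
      by (rule minus_equality) (use that in \<open>auto simp: poly_ring_simps polys_uminus\<close>)
    show "subgroup I (add_monoid (poly_ring E))"
    proof (rule add.subgroupI)
      fix a assume a: "a \<in> I"
      then have "(- 1) * a \<in> I" using R polys_uminus [OF polys_one] by blast
      then show "\<ominus>\<^bsub>poly_ring E\<^esub> a \<in> I" using inv a R by auto
    qed (use R in \<open>auto simp: poly_ring_simps\<close>)
  qed (use R in \<open>auto simp: poly_ring_simps mult.commute\<close>)
qed

section \<open>The tensor product of the Hilbert--Burch complexes\<close>

text \<open>
  A cycle with edge set \<open>insert z A\<close> is encoded as the pair \<open>(z, A)\<close>. The ideal generated by the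
  products of all but one of its edges has the generators \<open>(False, e)\<close> for \<open>e \<in> insert z A\<close> and
  the syzygies \<open>(True, a)\<close> for \<open>a \<in> A\<close>, the latter standing for the relation between the
  generators of \<open>a\<close> and \<open>z\<close>. A basis element of the tensor product is a list of such choices, of
  degree the number of syzygies in it.
\<close>

type_synonym 'e cell = "(bool \<times> 'e) list"
type_synonym ('e, 'k) chain = "'e cell \<Rightarrow> ('e, 'k) mpoly"

fun cells :: "('e \<times> 'e set) list \<Rightarrow> nat \<Rightarrow> 'e cell set" where
  "cells [] i = (if i = 0 then {[]} else {})"
| "cells (c # cs) i =
     (\<lambda>(e, l). (False, e) # l) ` (insert (fst c) (snd c) \<times> cells cs i) \<union>
     (if i = 0 then {} else (\<lambda>(a, l). (True, a) # l) ` (snd c \<times> cells cs (i - 1)))"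

text \<open>Total functions that vanish off the cells: fixing the first entry of the list then gives
  a chain of the remaining cycles, which is what the inductions on \<open>cs\<close> use.\<close>

definition chains :: "'e set \<Rightarrow> ('e \<times> 'e set) list \<Rightarrow> nat \<Rightarrow> ('e, 'k::field) chain set" where
  "chains E cs i = {u. (\<forall>l. u l \<in> polys E) \<and> (\<forall>l. l \<notin> cells cs i \<longrightarrow> u l = 0)}"

text \<open>The Hilbert--Burch matrix applied to \<open>w\<close>: the column of \<open>a\<close>
  has \<open>indet a\<close> in row \<open>a\<close> and \<open>- indet z\<close> in row
  \<open>z\<close>.\<close>

definition syz :: "'e \<Rightarrow> 'e set \<Rightarrow> ('e \<Rightarrow> ('e, 'k::field) mpoly) \<Rightarrow> 'e \<Rightarrow> ('e, 'k) mpoly" where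
  "syz z A w e = (if e = z then - (indet z * (\<Sum>a\<in>A. w a)) else indet e * w e)"

text \<open>The differential of the tensor product of the two-term complex of \<open>c\<close> with
  the complex of \<open>cs\<close>. The minus sign in the syzygy coordinates is the Koszul
  sign.\<close>

fun bd :: "('e \<times> 'e set) list \<Rightarrow> ('e, 'k::field) chain \<Rightarrow> ('e, 'k) chain" where
  "bd [] u l = 0"
| "bd (c # cs) u [] = 0"
| "bd (c # cs) u ((True, e) # l) = - bd cs (\<lambda>k. u ((True, e) # k)) l"
| "bd (c # cs) u ((False, e) # l) =
     bd cs (\<lambda>k. u ((False, e) # k)) l + syz (fst c) (snd c) (\<lambda>a. u ((True, a) # l)) e"

text \<open>\<open>D\<close> is meant for the edges on no cycle; they lie in every basis, so their
  product enters once, at the end of the list.\<close>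

fun cell_mon :: "'e set \<Rightarrow> ('e \<times> 'e set) list \<Rightarrow> 'e cell \<Rightarrow> ('e, 'k::field) mpoly" where
  "cell_mon D [] l = (\<Prod>j\<in>D. indet j)"
| "cell_mon D (c # cs) [] = 0"
| "cell_mon D (c # cs) (x # l) =
     (\<Prod>j\<in>insert (fst c) (snd c) - {snd x}. indet j) * cell_mon D cs l"

definition aug :: "'e set \<Rightarrow> ('e \<times> 'e set) list \<Rightarrow> ('e, 'k::field) chain \<Rightarrow> ('e, 'k) mpoly" where
  "aug D cs u = (\<Sum>l\<in>cells cs 0. u l * cell_mon D cs l)"

definition support :: "'e set \<Rightarrow> ('e \<times> 'e set) list \<Rightarrow> 'e set" where
  "support D cs = D \<union> (\<Union>c\<in>set cs. insert (fst c) (snd c))"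

text \<open>The factors of the product ideal thus live in disjoint sets of indeterminates, and
  division by an indeterminate of one factor does not affect the others.\<close>

fun separated :: "'e set \<Rightarrow> ('e \<times> 'e set) list \<Rightarrow> bool" where
  "separated D [] \<longleftrightarrow> finite D"
| "separated D (c # cs) \<longleftrightarrow> finite (snd c) \<and> fst c \<notin> snd c \<and>
     insert (fst c) (snd c) \<inter> support D cs = {} \<and> separated D cs"

lemma support_Cons: "support D (c # cs) = insert (fst c) (snd c) \<union> support D cs"
  by (auto simp: support_def)

lemma finite_cells: "separated D cs \<Longrightarrow> finite (cells cs i)"
  by (induction cs arbitrary: i) auto

section \<open>Linearity of the boundary and of the augmentation\<close>

lemma syz_add: "syz z A (\<lambda>a. v a + w a) e = syz z A v e + syz z A w e"
  by (simp add: syz_def sum.distrib distrib_left)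

lemma syz_scale: "syz z A (\<lambda>a. r * w a) e = r * syz z A w e"
  by (simp add: syz_def sum_distrib_left mult.left_commute)

lemma bd_add: "bd cs (\<lambda>l. u l + v l) l = bd cs u l + bd cs v l"
proof (induction cs arbitrary: u v l)
  case (Cons c cs)
  show ?case
  proof (cases l)
    case (Cons x k)
    then show ?thesis
      by (cases x; cases "fst x") (auto simp: Cons.IH syz_add)
  qed simp
qed simp

lemma bd_scale: "bd cs (\<lambda>l. r * u l) l = r * bd cs u l"
proof (induction cs arbitrary: u l)
  case (Cons c cs)
  show ?case
  proof (cases l)
    case (Cons x k)
    then show ?thesis
      by (cases x; cases "fst x") (auto simp: Cons.IH syz_scale distrib_left)
  qed simp
qed simp

lemma bd_uminus: "bd cs (\<lambda>l. - u l) l = - bd cs u l"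
  using bd_scale [of cs "- 1" u l] by simp

lemma bd_diff: "bd cs (\<lambda>l. u l - v l) l = bd cs u l - bd cs v l"
  using bd_add [of cs u "\<lambda>l. - v l" l] by (simp add: bd_uminus)

lemma bd_zero: "bd cs (\<lambda>l. 0) l = 0"
  using bd_scale [of cs 0 "\<lambda>l. 0" l] by simp

lemma bd_sum: "bd cs (\<lambda>l. \<Sum>a\<in>A. f a l) l = (\<Sum>a\<in>A. bd cs (f a) l)"
  by (induction A rule: infinite_finite_induct) (auto simp: bd_add bd_zero)

text \<open>The differentials of the two tensor factors commute, since \<open>syz\<close> forms
  linear combinations of chains with fixed coefficients.\<close>

lemma bd_syz: "bd cs (\<lambda>l. syz z A (\<lambda>a. w a l) e) l = syz z A (\<lambda>a. bd cs (w a) l) e"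
  by (simp add: syz_def bd_uminus bd_scale bd_sum)

lemma aug_add: "aug D cs (\<lambda>l. u l + v l) = aug D cs u + aug D cs v"
  by (simp add: aug_def distrib_right sum.distrib)

lemma aug_scale: "aug D cs (\<lambda>l. r * u l) = r * aug D cs u"
  by (simp add: aug_def sum_distrib_left mult.assoc)

lemma aug_uminus: "aug D cs (\<lambda>l. - u l) = - aug D cs u"
  using aug_scale [of D cs "- 1" u] by simp

lemma aug_diff: "aug D cs (\<lambda>l. u l - v l) = aug D cs u - aug D cs v"
  using aug_add [of D cs u "\<lambda>l. - v l"] by (simp add: aug_uminus)

lemma aug_zero: "aug D cs (\<lambda>l. 0) = 0"
  by (simp add: aug_def)

lemma aug_sum: "aug D cs (\<lambda>l. \<Sum>a\<in>A. f a l) = (\<Sum>a\<in>A. aug D cs (f a))"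
  by (induction A rule: infinite_finite_induct) (auto simp: aug_add aug_zero)

lemma aug_syz: "aug D cs (\<lambda>l. syz z A (\<lambda>a. w a l) e) = syz z A (\<lambda>a. aug D cs (w a)) e"
  by (simp add: syz_def aug_uminus aug_scale aug_sum)

text \<open>A cell of degree zero is a generator of the first cycle followed by a cell of degree
  zero of the rest, so the sum over cells becomes a double sum.\<close>

lemma aug_Cons:
  assumes "separated D (c # cs)"
  shows "aug D (c # cs) u = (\<Sum>e\<in>insert (fst c) (snd c).
    (\<Prod>j\<in>insert (fst c) (snd c) - {e}. indet j) * aug D cs (\<lambda>l. u ((False, e) # l)))"
proof -
  have "aug D (c # cs) u = (\<Sum>(e, l)\<in>insert (fst c) (snd c) \<times> cells cs 0.
      u ((False, e) # l) * cell_mon D (c # cs) ((False, e) # l))"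
    unfolding aug_def
    by (simp add: sum.reindex inj_on_def case_prod_unfold del: cell_mon.simps)
  also have "\<dots> = (\<Sum>e\<in>insert (fst c) (snd c). \<Sum>l\<in>cells cs 0.
      u ((False, e) # l) * cell_mon D (c # cs) ((False, e) # l))"
    by (rule sum.cartesian_product [symmetric])
  finally show ?thesis
    by (simp only: aug_def sum_distrib_left cell_mon.simps snd_conv mult.left_commute)
qed

lemma div_indet_mult_cell_mon:
  assumes "separated D cs" "x \<notin> support D cs"
  shows "div_indet x (f * cell_mon D cs l) = div_indet x f * cell_mon D cs l"
  using assms
proof (induction D cs l arbitrary: f rule: cell_mon.induct)
  case (1 D l)
  then show ?case by (simp add: div_indet_mult_prod support_def)
next
  case (3 D c cs y l)
  let ?P = "\<Prod>j\<in>insert (fst c) (snd c) - {snd y}. indet j :: ('a, 'b) mpoly"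
  have "div_indet x (f * ?P * cell_mon D cs l) = div_indet x (f * ?P) * cell_mon D cs l"
    using 3 by (simp add: support_Cons)
  also have "div_indet x (f * ?P) = div_indet x f * ?P"
    using 3 by (intro div_indet_mult_prod) (auto simp: support_Cons)
  finally show ?case by (simp add: mult.assoc)
qed simp

text \<open>This provides preimages: dividing the coefficients of a chain divides its
  augmentation.\<close>

lemma div_indet_aug:
  assumes "separated D cs" "x \<notin> support D cs"
  shows "div_indet x (aug D cs u) = aug D cs (\<lambda>l. div_indet x (u l))"
  using assms by (simp add: aug_def div_indet_sum div_indet_mult_cell_mon)

section \<open>Chains described by their first coordinate\<close>

lemma chains_Nil: "u \<in> chains E [] i \<longleftrightarrow>
    u [] \<in> polys E \<and> (\<forall>l. (l \<noteq> [] \<or> i > 0) \<longrightarrow> u l = 0)"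
  by (auto simp: chains_def split: if_splits) (metis polys_zero)

lemma cells_Cons_iff:
  "[] \<notin> cells (c # cs) i"
  "(False, e) # l \<in> cells (c # cs) i \<longleftrightarrow> e \<in> insert (fst c) (snd c) \<and> l \<in> cells cs i"
  "(True, e) # l \<in> cells (c # cs) i \<longleftrightarrow> e \<in> snd c \<and> i > 0 \<and> l \<in> cells cs (i - 1)"
  by auto

lemma chains_Cons_Nil: "u \<in> chains E (c # cs) i \<Longrightarrow> u [] = 0"
  by (simp add: chains_def cells_Cons_iff del: cells.simps)

lemma chains_Cons_False:
  assumes "u \<in> chains E (c # cs) i"
  shows "if e \<in> insert (fst c) (snd c) then (\<lambda>l. u ((False, e) # l)) \<in> chains E cs i
    else (\<forall>l. u ((False, e) # l) = 0)"
  using assms by (auto simp: chains_def cells_Cons_iff simp del: cells.simps)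

lemma chains_Cons_True:
  assumes "u \<in> chains E (c # cs) i"
  shows "if e \<in> snd c \<and> i > 0 then (\<lambda>l. u ((True, e) # l)) \<in> chains E cs (i - 1)
    else (\<forall>l. u ((True, e) # l) = 0)"
  using assms by (auto simp: chains_def cells_Cons_iff simp del: cells.simps)

lemma chains_Cons_True_Suc:
  assumes "u \<in> chains E (c # cs) (Suc i)"
  shows "if e \<in> snd c then (\<lambda>l. u ((True, e) # l)) \<in> chains E cs i
    else (\<forall>l. u ((True, e) # l) = 0)"
  using chains_Cons_True [OF assms, of e] by (cases "e \<in> snd c") simp_all

lemma chains_ConsI:
  assumes "u [] = 0"
    and "\<And>e. if e \<in> insert (fst c) (snd c) then (\<lambda>l. u ((False, e) # l)) \<in> chains E cs i
      else (\<forall>l. u ((False, e) # l) = 0)"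
    and "\<And>e. if e \<in> snd c \<and> i > 0 then (\<lambda>l. u ((True, e) # l)) \<in> chains E cs (i - 1)
      else (\<forall>l. u ((True, e) # l) = 0)"
  shows "u \<in> chains E (c # cs) i"
proof -
  have "u l \<in> polys E \<and> (l \<notin> cells (c # cs) i \<longrightarrow> u l = 0)" for l
  proof (cases l)
    case Nil
    then show ?thesis using assms(1) by simp
  next
    case (Cons x k)
    obtain b e where "x = (b, e)" by force
    then show ?thesis
      using Cons assms(2,3) [of e]
      by (cases b) (auto simp: cells_Cons_iff chains_def simp del: cells.simps split: if_splits)
  qed
  then show ?thesis by (simp add: chains_def)
qed

lemma chains_zero: "(\<lambda>l. 0) \<in> chains E cs i"
  by (simp add: chains_def)

lemma chains_add: "u \<in> chains E cs i \<Longrightarrow> v \<in> chains E cs i \<Longrightarrow> (\<lambda>l. u l + v l) \<in> chains E cs i"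
  by (simp add: chains_def polys_add)

lemma chains_scale: "r \<in> polys E \<Longrightarrow> u \<in> chains E cs i \<Longrightarrow> (\<lambda>l. r * u l) \<in> chains E cs i"
  by (simp add: chains_def polys_mult)

lemma chains_uminus: "u \<in> chains E cs i \<Longrightarrow> (\<lambda>l. - u l) \<in> chains E cs i"
  by (simp add: chains_def polys_uminus)

lemma chains_diff: "u \<in> chains E cs i \<Longrightarrow> v \<in> chains E cs i \<Longrightarrow> (\<lambda>l. u l - v l) \<in> chains E cs i"
  by (simp add: chains_def polys_diff)

lemma chains_sum:
  "(\<And>a. a \<in> A \<Longrightarrow> f a \<in> chains E cs i) \<Longrightarrow> (\<lambda>l. \<Sum>a\<in>A. f a l) \<in> chains E cs i"
  by (simp add: chains_def polys_sum)

lemma chains_div_indet: "u \<in> chains E cs i \<Longrightarrow> (\<lambda>l. div_indet x (u l)) \<in> chains E cs i"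
  by (simp add: chains_def polys_div_indet)

lemma chains_syz:
  assumes "\<And>a. a \<in> A \<Longrightarrow> w a \<in> chains E cs i" "insert z A \<subseteq> E" "e \<in> insert z A"
  shows "(\<lambda>l. syz z A (\<lambda>a. w a l) e) \<in> chains E cs i"
proof (cases "e = z")
  case True
  then show ?thesis using assms
    by (simp add: syz_def chains_uminus chains_scale chains_sum polys_indet)
next
  case False
  then show ?thesis using assms
    by (auto simp: syz_def intro!: chains_scale polys_indet)
qed

section \<open>The complex property: degrees, vanishing squares, augmentation\<close>

lemma bd_chain_0:
  assumes "u \<in> chains E cs 0"
  shows "bd cs u = (\<lambda>l. 0)"
proof
  fix l
  show "bd cs u l = 0"
    using assms
  proof (induction cs arbitrary: u l)
    case (Cons c cs)
    show ?case
    proof (cases l)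
      case (Cons x k)
      obtain b e where x: "x = (b, e)" by force
      have T: "u ((True, a) # m) = 0" for a m
        using chains_Cons_True [OF Cons.prems, of a] by simp
      have "if e \<in> insert (fst c) (snd c) then (\<lambda>l. u ((False, e) # l)) \<in> chains E cs 0
          else \<forall>l. u ((False, e) # l) = 0"
        by (rule chains_Cons_False [OF Cons.prems])
      then have "bd cs (\<lambda>k. u ((False, e) # k)) k = 0"
        by (auto simp: Cons.IH bd_zero split: if_splits)
      then show ?thesis using Cons x by (cases b) (auto simp: T bd_zero syz_def)
    qed simp
  qed simp
qed

lemma bd_chains:
  assumes "u \<in> chains E cs (Suc i)" "support D cs \<subseteq> E"
  shows "bd cs u \<in> chains E cs i"
  using assms
proof (induction cs arbitrary: u i)
  case Nil
  then show ?case by (simp add: chains_Nil)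
next
  case (Cons c cs)
  have F: "if e \<in> insert (fst c) (snd c) then (\<lambda>l. u ((False, e) # l)) \<in> chains E cs (Suc i)
      else \<forall>l. u ((False, e) # l) = 0" for e
    by (rule chains_Cons_False [OF Cons.prems(1)])
  have T: "if e \<in> snd c then (\<lambda>l. u ((True, e) # l)) \<in> chains E cs i
      else \<forall>l. u ((True, e) # l) = 0" for e
    by (rule chains_Cons_True_Suc [OF Cons.prems(1)])
  have sub: "support D cs \<subseteq> E" "insert (fst c) (snd c) \<subseteq> E"
    using Cons.prems(2) by (auto simp: support_Cons)
  have 1: "if e \<in> insert (fst c) (snd c) then (\<lambda>l. bd (c # cs) u ((False, e) # l)) \<in> chains E cs i
      else \<forall>l. bd (c # cs) u ((False, e) # l) = 0" for e
  proof (cases "e \<in> insert (fst c) (snd c)")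
    case True
    have "bd cs (\<lambda>k. u ((False, e) # k)) \<in> chains E cs i"
      using F [of e] True sub by (intro Cons.IH) auto
    moreover have "(\<lambda>l. syz (fst c) (snd c) (\<lambda>a. u ((True, a) # l)) e) \<in> chains E cs i"
      by (rule chains_syz) (use T True sub in \<open>auto split: if_splits\<close>)
    ultimately show ?thesis using True by (simp add: chains_add)
  next
    case False
    then show ?thesis using F [of e] T [of e] by (auto simp: bd_zero syz_def)
  qed
  have 2: "if e \<in> snd c \<and> i > 0 then (\<lambda>l. bd (c # cs) u ((True, e) # l)) \<in> chains E cs (i - 1)
      else \<forall>l. bd (c # cs) u ((True, e) # l) = 0" for e
  proof (cases "e \<in> snd c")
    case True
    then have T': "(\<lambda>l. u ((True, e) # l)) \<in> chains E cs i"
      using T [of e] by simp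
    \<comment> \<open>The tail in a syzygy coordinate has degree \<open>i\<close>. For
      \<open>i = 0\<close> its boundary has to vanish, since \<open>i - 1\<close> is truncated and
      gives no lower degree.\<close>
    show ?thesis
    proof (cases i)
      case 0
      then show ?thesis using bd_chain_0 T' by fastforce
    next
      case (Suc j)
      then have "bd cs (\<lambda>l. u ((True, e) # l)) \<in> chains E cs j"
        using Cons.IH T' sub by simp
      then show ?thesis using Suc True by (simp add: chains_uminus)
    qed
  next
    case False
    then show ?thesis using T [of e] by (auto simp: bd_zero)
  qed
  show ?case by (rule chains_ConsI [OF _ 1 2]) simp
qed

text \<open>The two mixed terms are equal up to sign by \<open>bd_syz\<close>, and the sign in the
  syzygy coordinates makes them cancel.\<close>

lemma bd_bd: "bd cs (bd cs u) l = 0"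
proof (induction cs arbitrary: u l)
  case (Cons c cs)
  show ?case
  proof (cases l)
    case (Cons x k)
    obtain b e where x: "x = (b, e)" by force
    have minus: "syz z A (\<lambda>a. - w a) d = - syz z A w d"
      for z A d and w :: "'a \<Rightarrow> ('a, 'b) mpoly"
      using syz_scale [of z A "- 1" w d] by simp
    show ?thesis
      using Cons x by (cases b) (simp_all add: bd_add bd_uminus Cons.IH bd_syz minus)
  qed simp
qed simp

text \<open>Each generator times its own indeterminate is the product over the whole cycle, so the
  row of \<open>z\<close> cancels the rows of \<open>A\<close>.\<close>

lemma sum_prod_remove_mult_syz:
  assumes "finite A" "z \<notin> A"
  shows "(\<Sum>e\<in>insert z A. (\<Prod>j\<in>insert z A - {e}. indet j) * syz z A w e) = 0"
proof -
  let ?P = "\<Prod>j\<in>insert z A. indet j"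
  have P: "(\<Prod>j\<in>insert z A - {e}. indet j) * (indet e * f) = ?P * f" if "e \<in> insert z A" for e f
  proof -
    have eq: "?P = indet e * (\<Prod>j\<in>insert z A - {e}. indet j)"
      using that assms by (intro prod.remove) auto
    show ?thesis unfolding eq by (simp only: mult.assoc mult.left_commute)
  qed
  have "(\<Sum>e\<in>A. (\<Prod>j\<in>insert z A - {e}. indet j) * syz z A w e) = (\<Sum>e\<in>A. ?P * w e)"
  proof (rule sum.cong)
    fix e assume e: "e \<in> A"
    then have "syz z A w e = indet e * w e"
      using assms by (auto simp: syz_def)
    then show "(\<Prod>j\<in>insert z A - {e}. indet j) * syz z A w e = ?P * w e"
      using P [of e "w e"] e by simp
  qed simp
  moreover have "(\<Prod>j\<in>insert z A - {z}. indet j) * syz z A w z = - (?P * (\<Sum>e\<in>A. w e))"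
    using P [of z "\<Sum>e\<in>A. w e"] by (simp add: syz_def)
  ultimately show ?thesis
    using assms by (simp add: sum_distrib_left)
qed

text \<open>The boundary of the remaining cycles is killed by induction; what is left is a
  combination of the syzygies of the first cycle, with augmentations as coefficients.\<close>

lemma aug_bd:
  assumes "separated D cs" "u \<in> chains E cs 1"
  shows "aug D cs (bd cs u) = 0"
  using assms
proof (induction cs arbitrary: u)
  case Nil
  then show ?case by (simp add: aug_def)
next
  case (Cons c cs)
  have "aug D cs (\<lambda>l. bd (c # cs) u ((False, e) # l)) =
      syz (fst c) (snd c) (\<lambda>a. aug D cs (\<lambda>l. u ((True, a) # l))) e"
    if "e \<in> insert (fst c) (snd c)" for e
  proof -
    have "(\<lambda>l. u ((False, e) # l)) \<in> chains E cs 1"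
      using chains_Cons_False [OF Cons.prems(2), of e] that by simp
    then have "aug D cs (bd cs (\<lambda>l. u ((False, e) # l))) = 0"
      using Cons.prems Cons.IH by simp
    then show ?thesis by (simp add: aug_add aug_syz)
  qed
  then have eq: "aug D (c # cs) (bd (c # cs) u) = (\<Sum>e\<in>insert (fst c) (snd c).
      (\<Prod>j\<in>insert (fst c) (snd c) - {e}. indet j) *
      syz (fst c) (snd c) (\<lambda>a. aug D cs (\<lambda>l. u ((True, a) # l))) e)"
    unfolding aug_Cons [OF Cons.prems(1)] by (intro sum.cong) simp_all
  show ?case unfolding eq
    using Cons.prems(1) by (intro sum_prod_remove_mult_syz) auto
qed

subsection \<open>Exactness\<close>

fun glue :: "'e \<times> 'e set \<Rightarrow> ('e \<Rightarrow> ('e, 'k::field) chain) \<Rightarrow> ('e \<Rightarrow> ('e, 'k) chain) \<Rightarrow> ('e, 'k) chain" where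
  "glue c f g [] = 0"
| "glue c f g ((False, e) # l) = (if e \<in> insert (fst c) (snd c) then f e l else 0)"
| "glue c f g ((True, e) # l) = (if e \<in> snd c then g e l else 0)"

lemma glue_chains:
  assumes "\<And>e. e \<in> insert (fst c) (snd c) \<Longrightarrow> f e \<in> chains E cs (Suc i)"
    and "\<And>a. a \<in> snd c \<Longrightarrow> g a \<in> chains E cs i"
  shows "glue c f g \<in> chains E (c # cs) (Suc i)"
proof (rule chains_ConsI)
  fix e
  show "if e \<in> insert (fst c) (snd c)
      then (\<lambda>l. glue c f g ((False, e) # l)) \<in> chains E cs (Suc i)
      else (\<forall>l. glue c f g ((False, e) # l) = 0)"
    using assms(1) by auto
  show "if e \<in> snd c \<and> 0 < Suc i then (\<lambda>l. glue c f g ((True, e) # l)) \<in> chains E cs (Suc i - 1)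
      else (\<forall>l. glue c f g ((True, e) # l) = 0)"
    using assms(2) by auto
qed simp

text \<open>The condition on \<open>e\<close> matters: outside \<open>insert z A\<close> the value
  at \<open>e\<close> itself would be read, where nothing is known.\<close>

lemma syz_cong:
  assumes "\<And>a. a \<in> A \<Longrightarrow> v a = w a" "e \<in> insert z A"
  shows "syz z A v e = syz z A w e"
proof -
  have sum: "sum v A = sum w A" using assms(1) by (rule sum.cong [OF refl])
  show ?thesis
  proof (cases "e = z")
    case True
    then show ?thesis by (simp only: syz_def sum if_True simp_thms)
  next
    case False
    then have "v e = w e" using assms by blast
    then show ?thesis using False by (simp only: syz_def if_False)
  qed
qed

text \<open>
  It suffices to correct a chain \<open>u\<close> to a boundary in the coordinates without a syzygy of the first
  cycle, once this has been done in the other ones.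
\<close>

lemma boundaryI:
  assumes u: "u \<in> chains E (c # cs) i"
    and sep: "fst c \<notin> snd c"
    and g: "\<And>a. a \<in> snd c \<Longrightarrow> g a \<in> chains E cs i"
    and u_g: "\<And>a l. a \<in> snd c \<Longrightarrow> u ((True, a) # l) = - bd cs (g a) l"
    and f: "\<And>e. e \<in> insert (fst c) (snd c) \<Longrightarrow> \<exists>f\<in>chains E cs (Suc i).
        (\<lambda>l. u ((False, e) # l) - syz (fst c) (snd c) (\<lambda>a. g a l) e) = bd cs f"
  shows "\<exists>w\<in>chains E (c # cs) (Suc i). u = bd (c # cs) w"
proof -
  have "\<forall>e\<in>insert (fst c) (snd c). \<exists>f. f \<in> chains E cs (Suc i) \<and>
      (\<lambda>l. u ((False, e) # l) - syz (fst c) (snd c) (\<lambda>a. g a l) e) = bd cs f"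
    using f by blast
  from bchoice [OF this] obtain f
    where f_chain: "\<And>e. e \<in> insert (fst c) (snd c) \<Longrightarrow> f e \<in> chains E cs (Suc i)"
      and f_eq: "\<And>e. e \<in> insert (fst c) (snd c) \<Longrightarrow>
        (\<lambda>l. u ((False, e) # l) - syz (fst c) (snd c) (\<lambda>a. g a l) e) = bd cs (f e)"
    by blast
  have "u l = bd (c # cs) (glue c f g) l" for l
  proof (cases l)
    case Nil
    then show ?thesis using chains_Cons_Nil [OF u] by simp
  next
    case (Cons x k)
    obtain b e where x: "x = (b, e)" by force
    show ?thesis
    proof (cases b)
      case True
      then show ?thesis
        using Cons x u_g [of e k] chains_Cons_True [OF u, of e]
        by (cases "e \<in> snd c") (auto simp: bd_zero)
    next
      case False
      show ?thesis
      proof (cases "e \<in> insert (fst c) (snd c)")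
        case True
        have "syz (fst c) (snd c) (\<lambda>a. glue c f g ((True, a) # k)) e =
            syz (fst c) (snd c) (\<lambda>a. g a k) e"
          using True by (intro syz_cong) simp_all
        moreover have "u ((False, e) # k) =
            bd cs (f e) k + syz (fst c) (snd c) (\<lambda>a. g a k) e"
          using fun_cong [OF f_eq [OF True], of k] by (simp add: algebra_simps)
        ultimately show ?thesis using Cons x False True by simp
      next
        case F: False
        then show ?thesis
          using Cons x False chains_Cons_False [OF u, of e]
          by (auto simp: bd_zero syz_def)
      qed
    qed
  qed
  moreover have "glue c f g \<in> chains E (c # cs) (Suc i)"
    using f_chain g by (rule glue_chains)
  ultimately show ?thesis by blast
qed

text \<open>The relation among the augmentations of the coordinates \<open>U e\<close> forces
  \<open>indet e\<close> to divide the one at \<open>e\<close>. The quotients sum to zero, and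
  lifted to chains \<open>g a\<close> they serve as coefficients of syzygies. Subtracting these
  syzygies leaves coordinates with augmentation zero, to which induction applies.\<close>

lemma aug_exact:
  assumes "separated D cs" "support D cs \<subseteq> E" "u \<in> chains E cs 0" "aug D cs u = 0"
  shows "\<exists>w\<in>chains E cs 1. u = bd cs w"
  using assms
proof (induction cs arbitrary: u)
  case Nil
  then have "u [] = 0" by (simp add: aug_def mult_prod_indet_eq_0)
  then have "u l = 0" for l
    using Nil by (cases "l = []") (auto simp: chains_Nil)
  then have "u = bd [] (\<lambda>l. 0)" by auto
  then show ?case using chains_zero by blast
next
  case (Cons c cs)
  define z A where "z = fst c" and "A = snd c"
  have A: "finite A" "z \<notin> A" "insert z A \<inter> support D cs = {}" and sep: "separated D cs"
    using Cons.prems(1) by (auto simp: z_def A_def)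
  have sub: "support D cs \<subseteq> E" "insert z A \<subseteq> E"
    using Cons.prems(2) by (auto simp: support_Cons z_def A_def)
  define U where "U e = (\<lambda>l. u ((False, e) # l))" for e
  have U: "U e \<in> chains E cs 0" if "e \<in> insert z A" for e
    using chains_Cons_False [OF Cons.prems(3), of e] that by (simp add: U_def z_def A_def)
  define P where "P e = (\<Prod>j\<in>insert z A - {e}. indet j :: ('a, 'b) mpoly)" for e
  have sum0: "(\<Sum>e\<in>insert z A. P e * aug D cs (U e)) = 0"
    using aug_Cons [OF Cons.prems(1), of u] Cons.prems(4)
    by (simp add: P_def U_def z_def A_def)
  have dvd: "aug D cs (U e) = indet e * div_indet e (aug D cs (U e))" if e: "e \<in> insert z A" for e
  proof -
    \<comment> \<open>\<open>R f\<close> is the remainder of \<open>f\<close> modulo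
      \<open>indet e\<close>. It kills \<open>P d\<close> for \<open>d \<noteq> e\<close>, which
      contains the factor \<open>indet e\<close>, and it is linear over \<open>P e\<close>, which
      does not. So only the term of \<open>e\<close> survives in \<open>sum0\<close>.\<close>
    define R where "R f = f - indet e * div_indet e f" for f :: "('a, 'b) mpoly"
    have R0: "R (P d * f) = 0" if d: "d \<in> insert z A" "d \<noteq> e" for d f
    proof -
      have "P d = indet e * (\<Prod>j\<in>insert z A - {d} - {e}. indet j)"
        unfolding P_def using A d e by (intro prod.remove) auto
      then have "P d * f = indet e * ((\<Prod>j\<in>insert z A - {d} - {e}. indet j) * f)"
        by (simp add: mult.assoc)
      then show ?thesis by (simp add: R_def div_indet_mult)
    qed
    have "R (\<Sum>d\<in>insert z A. P d * aug D cs (U d)) =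
        (\<Sum>d\<in>insert z A. R (P d * aug D cs (U d)))"
      by (simp only: R_def div_indet_sum sum_subtractf sum_distrib_left)
    also have "\<dots> = R (P e * aug D cs (U e))"
      using A e by (subst sum.remove [of _ e]) (simp_all add: R0)
    also have "\<dots> = R (aug D cs (U e)) * P e"
    proof -
      have "div_indet e (f * P e) = div_indet e f * P e" for f
        unfolding P_def using A by (intro div_indet_mult_prod) auto
      then show ?thesis
        by (simp only: R_def mult.commute [of "P e"] left_diff_distrib mult.assoc)
    qed
    finally have "R (aug D cs (U e)) * P e = 0"
      unfolding sum0 by (simp add: R_def)
    then have "R (aug D cs (U e)) = 0"
      using A by (simp add: P_def mult_prod_indet_eq_0)
    then show ?thesis by (simp add: R_def)
  qed
  define b where "b e = div_indet e (aug D cs (U e))" for e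
  have aug_U: "aug D cs (U e) = indet e * b e" if "e \<in> insert z A" for e
    using dvd [OF that] by (simp add: b_def)
  \<comment> \<open>Coefficientwise division lifts the quotient \<open>b a\<close> to a chain, as
    \<open>a\<close> is outside the support of \<open>cs\<close>.\<close>
  define g where "g a = (\<lambda>l. div_indet a (U a l))" for a
  have g: "g a \<in> chains E cs 0" if "a \<in> A" for a
    unfolding g_def using that U by (intro chains_div_indet) auto
  have aug_g: "aug D cs (g a) = b a" if "a \<in> A" for a
    unfolding g_def b_def using that A sep by (subst div_indet_aug) auto
  \<comment> \<open>Every summand of \<open>sum0\<close> is \<open>b e\<close> times the product
    over the whole cycle, which cancels.\<close>
  have b_sum: "b z = - (\<Sum>a\<in>A. b a)"
  proof -
    have "P e * (indet e * f) = f * (\<Prod>j\<in>insert z A. indet j)" if "e \<in> insert z A" for e f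
    proof -
      have eq: "(\<Prod>j\<in>insert z A. indet j) = indet e * P e"
        unfolding P_def using that A by (intro prod.remove) auto
      show ?thesis unfolding eq by (simp only: mult.assoc mult.left_commute mult.commute)
    qed
    then have "(\<Sum>e\<in>insert z A. P e * aug D cs (U e)) =
        (\<Sum>e\<in>insert z A. b e * (\<Prod>j\<in>insert z A. indet j))"
      by (intro sum.cong) (simp_all add: aug_U)
    also have "\<dots> = (\<Sum>e\<in>insert z A. b e) * (\<Prod>j\<in>insert z A. indet j)"
      by (simp only: sum_distrib_right)
    finally have "(\<Sum>e\<in>insert z A. b e) = 0"
      using sum0 A mult_prod_indet_eq_0 [of "insert z A" "\<Sum>e\<in>insert z A. b e"] by simp
    then show ?thesis using A by (simp add: eq_neg_iff_add_eq_0)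
  qed
  show ?case
  proof (unfold One_nat_def, rule boundaryI [OF Cons.prems(3)])
    fix a l assume a: "a \<in> snd c"
    show "g a \<in> chains E cs 0" using a g by (simp add: A_def)
    \<comment> \<open>In degree zero both sides vanish: \<open>u\<close> has no syzygy coordinates
      and \<open>g a\<close> has no boundary.\<close>
    show "u ((True, a) # l) = - bd cs (g a) l"
      using chains_Cons_True [OF Cons.prems(3), of a] bd_chain_0 [OF g, of a] a
      by (simp add: A_def)
  next
    fix e assume e: "e \<in> insert (fst c) (snd c)"
    let ?v = "\<lambda>l. U e l - syz z A (\<lambda>a. g a l) e"
    have e': "e \<in> insert z A" using e by (simp add: z_def A_def)
    have "syz z A (\<lambda>a. aug D cs (g a)) e = syz z A b e"
      using e' by (intro syz_cong) (simp_all add: aug_g)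
    \<comment> \<open>For \<open>e\<close> in \<open>A\<close> this is the definition of the
      quotient; for \<open>z\<close> it is the vanishing of the sum of the quotients.\<close>
    also have "\<dots> = aug D cs (U e)"
      using aug_U [OF e'] b_sum by (auto simp: syz_def)
    finally have "aug D cs ?v = 0"
      by (simp add: aug_diff aug_syz)
    moreover have "?v \<in> chains E cs 0"
      using e' sub g U by (intro chains_diff chains_syz) auto
    ultimately have "\<exists>f\<in>chains E cs 1. ?v = bd cs f"
      using Cons.IH sep sub by simp
    then show "\<exists>f\<in>chains E cs (Suc 0).
        (\<lambda>l. u ((False, e) # l) - syz (fst c) (snd c) (\<lambda>a. g a l) e) = bd cs f"
      by (simp add: U_def z_def A_def)
  qed (use A in \<open>simp add: z_def A_def\<close>)
qed

text \<open>The syzygy coordinates of a cycle are boundaries of chains of the remaining cycles. Once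
  these are subtracted, the generator coordinates are cycles of the remaining complex, and induction
  applies to them as well.\<close>

lemma bd_exact:
  assumes "separated D cs" "support D cs \<subseteq> E" "u \<in> chains E cs (Suc i)" "bd cs u = (\<lambda>l. 0)"
  shows "\<exists>w\<in>chains E cs (Suc (Suc i)). u = bd cs w"
  using assms
proof (induction cs arbitrary: u i)
  case Nil
  then have "u = bd [] (\<lambda>l. 0)" by (auto simp: chains_Nil)
  then show ?case using chains_zero by blast
next
  case (Cons c cs)
  define z A where "z = fst c" and "A = snd c"
  have A: "finite A" "z \<notin> A" and sep: "separated D cs"
    using Cons.prems(1) by (auto simp: z_def A_def)
  have sub: "support D cs \<subseteq> E" "insert z A \<subseteq> E"
    using Cons.prems(2) by (auto simp: support_Cons z_def A_def)
  define U where "U e = (\<lambda>l. u ((False, e) # l))" for e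
  define W where "W a = (\<lambda>l. u ((True, a) # l))" for a
  have U: "U e \<in> chains E cs (Suc i)" if "e \<in> insert z A" for e
    using chains_Cons_False [OF Cons.prems(3), of e] that by (simp add: U_def z_def A_def)
  have W: "W a \<in> chains E cs i" if "a \<in> A" for a
    using chains_Cons_True_Suc [OF Cons.prems(3), of a] that by (simp add: W_def A_def)
  have bd_W: "bd cs (W a) l = 0" for a l
    using fun_cong [OF Cons.prems(4), of "(True, a) # l"] by (simp add: W_def)
  have bd_U: "bd cs (U e) l + syz z A (\<lambda>a. W a l) e = 0" for e l
    using fun_cong [OF Cons.prems(4), of "(False, e) # l"] by (simp add: U_def W_def z_def A_def)
  have "\<exists>w\<in>chains E cs (Suc i). W a = bd cs w" if a: "a \<in> A" for a
  proof (cases i)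
    \<comment> \<open>In degree zero a vanishing boundary says nothing about \<open>W a\<close>. But
      \<open>indet a * W a\<close> is up to sign the boundary of \<open>U a\<close>, hence has
      augmentation zero, and \<open>indet a\<close> can be cancelled.\<close>
    case 0
    have "aug D cs (bd cs (U a)) = 0"
      using sep U a 0 by (intro aug_bd) auto
    moreover have "bd cs (U a) = (\<lambda>l. - (indet a * W a l))"
    proof
      fix l
      have "a \<noteq> z" using a A by blast
      then show "bd cs (U a) l = - (indet a * W a l)"
        using bd_U [of a l] by (simp add: syz_def eq_neg_iff_add_eq_0)
    qed
    ultimately have "aug D cs (W a) = 0"
      by (simp add: aug_uminus aug_scale indet_mult_eq_0)
    then show ?thesis using aug_exact [OF sep sub(1)] W a 0 by auto
  next
    case (Suc j)
    then show ?thesis using Cons.IH [OF sep sub(1), of "W a" j] W [OF a] bd_W by auto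
  qed
  then obtain h where h: "\<And>a. a \<in> A \<Longrightarrow> h a \<in> chains E cs (Suc i)"
    and W_h: "\<And>a. a \<in> A \<Longrightarrow> W a = bd cs (h a)"
    by metis
  \<comment> \<open>The sign compensates the one of \<open>bd\<close> in the syzygy
    coordinates.\<close>
  define g where "g a = (\<lambda>l. - h a l)" for a
  have g: "g a \<in> chains E cs (Suc i)" if "a \<in> A" for a
    using h that by (simp add: g_def chains_uminus)
  have W_g: "W a l = - bd cs (g a) l" if "a \<in> A" for a l
    using W_h that by (simp add: g_def bd_uminus)
  show ?case
  proof (rule boundaryI [OF Cons.prems(3)])
    fix a l assume a: "a \<in> snd c"
    show "g a \<in> chains E cs (Suc i)" using a g by (simp add: A_def)
    show "u ((True, a) # l) = - bd cs (g a) l"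
      using W_g [of a l] a by (simp add: A_def W_def)
  next
    fix e assume e: "e \<in> insert (fst c) (snd c)"
    let ?v = "\<lambda>l. U e l - syz z A (\<lambda>a. g a l) e"
    have e': "e \<in> insert z A" using e by (simp add: z_def A_def)
    have "bd cs ?v l = 0" for l
    proof -
      have "syz z A (\<lambda>a. W a l) e = syz z A (\<lambda>a. - 1 * bd cs (g a) l) e"
        using e' by (intro syz_cong) (simp_all add: W_g)
      also have "\<dots> = - syz z A (\<lambda>a. bd cs (g a) l) e"
        by (simp only: syz_scale) simp
      finally show ?thesis using bd_U [of e l] by (simp add: bd_diff bd_syz)
    qed
    moreover have "?v \<in> chains E cs (Suc i)"
      using e' sub g U by (intro chains_diff chains_syz) auto
    ultimately have "\<exists>f\<in>chains E cs (Suc (Suc i)). ?v = bd cs f"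
      using Cons.IH [of ?v i] sep sub by auto
    then show "\<exists>f\<in>chains E cs (Suc (Suc i)).
        (\<lambda>l. u ((False, e) # l) - syz (fst c) (snd c) (\<lambda>a. g a l) e) = bd cs f"
      by (simp add: U_def z_def A_def)
  qed (use A in \<open>simp add: z_def A_def\<close>)
qed

subsection \<open>The augmentation ideal and minimality\<close>

lemma cell_mon_polys: "support D cs \<subseteq> E \<Longrightarrow> cell_mon D cs l \<in> polys E"
  by (induction D cs l rule: cell_mon.induct)
    (auto simp: support_Cons support_def intro!: polys_prod polys_mult polys_indet)

lemma aug_unit_chain:
  assumes "finite (cells cs 0)" "l \<in> cells cs 0"
  shows "aug D cs (\<lambda>k. if k = l then r else 0) = r * cell_mon D cs l"
proof -
  have "aug D cs (\<lambda>k. if k = l then r else 0) =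
      (\<Sum>k\<in>cells cs 0. if k = l then r * cell_mon D cs k else 0)"
    unfolding aug_def by (intro sum.cong) auto
  then show ?thesis using assms by simp
qed

lemma image_aug:
  assumes "separated D cs" "support D cs \<subseteq> E"
  shows "aug D cs ` chains E cs 0 = Idl\<^bsub>poly_ring E\<^esub> (cell_mon D cs ` cells cs 0)"
proof
  interpret cring "poly_ring E :: ('a, 'b) mpoly ring" by (rule cring_poly_ring)
  let ?G = "cell_mon D cs ` cells cs 0 :: ('a, 'b) mpoly set"
  have G: "?G \<subseteq> polys E" using assms by (auto intro: cell_mon_polys)
  have fin: "finite (cells cs 0)" using assms(1) by (rule finite_cells)
  have "ideal (Idl\<^bsub>poly_ring E\<^esub> ?G) (poly_ring E)" by (rule genideal_ideal [OF G])
  then have I: "0 \<in> Idl\<^bsub>poly_ring E\<^esub> ?G"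
    "\<And>a b. a \<in> Idl\<^bsub>poly_ring E\<^esub> ?G \<Longrightarrow> b \<in> Idl\<^bsub>poly_ring E\<^esub> ?G \<Longrightarrow> a + b \<in> Idl\<^bsub>poly_ring E\<^esub> ?G"
    "\<And>a r. a \<in> Idl\<^bsub>poly_ring E\<^esub> ?G \<Longrightarrow> r \<in> polys E \<Longrightarrow> r * a \<in> Idl\<^bsub>poly_ring E\<^esub> ?G"
    by (auto simp: ideal_poly_ring_iff)
  have sum_I: "sum f B \<in> Idl\<^bsub>poly_ring E\<^esub> ?G" if "\<And>x. x \<in> B \<Longrightarrow> f x \<in> Idl\<^bsub>poly_ring E\<^esub> ?G"
    for f :: "'a cell \<Rightarrow> ('a, 'b) mpoly" and B
    using that by (induction B rule: infinite_finite_induct) (auto simp: I)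
  have gen: "?G \<subseteq> Idl\<^bsub>poly_ring E\<^esub> ?G" by (rule genideal_self [OF G])
  show "aug D cs ` chains E cs 0 \<subseteq> Idl\<^bsub>poly_ring E\<^esub> ?G"
    using gen by (auto simp: aug_def chains_def intro!: sum_I I)
  show "Idl\<^bsub>poly_ring E\<^esub> ?G \<subseteq> aug D cs ` chains E cs 0"
  proof (rule genideal_minimal)
    have "aug D cs u \<in> polys E" if "u \<in> chains E cs 0" for u :: "('a, 'b) chain"
      using that assms
      by (auto simp: aug_def chains_def intro!: polys_sum polys_mult cell_mon_polys)
    moreover have "0 = aug D cs (\<lambda>l. 0 :: ('a, 'b) mpoly)" by (simp add: aug_zero)
    moreover have "aug D cs u + aug D cs v = aug D cs (\<lambda>l. u l + v l)"
      for u v :: "('a, 'b) chain" by (simp add: aug_add)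
    moreover have "r * aug D cs u = aug D cs (\<lambda>l. r * u l)"
      for u :: "('a, 'b) chain" and r by (simp add: aug_scale)
    ultimately show "ideal (aug D cs ` chains E cs 0) (poly_ring E :: ('a, 'b) mpoly ring)"
      unfolding ideal_poly_ring_iff
      by (auto intro!: imageI chains_zero chains_add chains_scale)
    show "?G \<subseteq> aug D cs ` chains E cs 0"
    proof
      fix p assume "p \<in> ?G"
      then obtain l where l: "l \<in> cells cs 0" "p = cell_mon D cs l" by blast
      let ?u = "\<lambda>k. if k = l then 1 else 0 :: ('a, 'b) mpoly"
      have "?u \<in> chains E cs 0" using l by (auto simp: chains_def)
      moreover have "p = aug D cs ?u" unfolding aug_unit_chain [OF fin l(1)] using l by simp
      ultimately show "p \<in> aug D cs ` chains E cs 0" by blast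
    qed
  qed
qed

lemma max_ideal_simps:
  shows "(0 :: ('e, 'k::field) mpoly) \<in> max_ideal E"
    and "a \<in> max_ideal E \<Longrightarrow> b \<in> max_ideal E \<Longrightarrow> a + b \<in> (max_ideal E :: ('e, 'k) mpoly set)"
    and "a \<in> max_ideal E \<Longrightarrow> r \<in> polys E \<Longrightarrow> a * r \<in> (max_ideal E :: ('e, 'k) mpoly set)"
    and "a \<in> max_ideal E \<Longrightarrow> - a \<in> (max_ideal E :: ('e, 'k) mpoly set)"
    and "e \<in> E \<Longrightarrow> indet e \<in> (max_ideal E :: ('e, 'k) mpoly set)"
proof -
  interpret cring "poly_ring E :: ('e, 'k) mpoly ring" by (rule cring_poly_ring)
  have sub: "indet ` E \<subseteq> (polys E :: ('e, 'k) mpoly set)" by (auto intro: polys_indet)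
  have "ideal (max_ideal E) (poly_ring E :: ('e, 'k) mpoly ring)"
    unfolding max_ideal_def by (rule genideal_ideal [OF sub])
  then show "(0 :: ('e, 'k) mpoly) \<in> max_ideal E"
    and "a \<in> max_ideal E \<Longrightarrow> b \<in> max_ideal E \<Longrightarrow> a + b \<in> (max_ideal E :: ('e, 'k) mpoly set)"
    and scale: "a \<in> max_ideal E \<Longrightarrow> r \<in> polys E \<Longrightarrow> a * r \<in> (max_ideal E :: ('e, 'k) mpoly set)" for r
    by (auto simp: ideal_poly_ring_iff mult.commute)
  show "a \<in> max_ideal E \<Longrightarrow> - a \<in> (max_ideal E :: ('e, 'k) mpoly set)"
    using scale [of "- 1"] polys_uminus [OF polys_one] by fastforce
  show "e \<in> E \<Longrightarrow> indet e \<in> (max_ideal E :: ('e, 'k) mpoly set)"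
    unfolding max_ideal_def using genideal_self [OF sub] by blast
qed

text \<open>This gives minimality: \<open>bd\<close> is assembled from \<open>syz\<close>, whose
  matrix entries are zero or indeterminates up to sign.\<close>

lemma bd_in_max_ideal:
  fixes u :: "('e, 'k::field) chain"
  assumes "u \<in> chains E cs (Suc i)" "support D cs \<subseteq> E"
  shows "bd cs u l \<in> max_ideal E"
  using assms
proof (induction cs arbitrary: u i l)
  case Nil
  then show ?case by (simp add: max_ideal_simps(1))
next
  case (Cons c cs)
  have sub: "support D cs \<subseteq> E" "insert (fst c) (snd c) \<subseteq> E"
    using Cons.prems(2) by (auto simp: support_Cons)
  have u: "u k \<in> polys E" for k
    using Cons.prems(1) by (simp add: chains_def)
  show ?case
  proof (cases l)
    case (Cons x k)
    obtain b e where x: "x = (b, e)" by force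
    have T: "bd cs (\<lambda>m. u ((True, e) # m)) k \<in> max_ideal E"
    proof (cases "e \<in> snd c")
      case True
      then have e: "(\<lambda>m. u ((True, e) # m)) \<in> chains E cs i"
        using chains_Cons_True_Suc [OF Cons.prems(1), of e] by simp
      show ?thesis
      proof (cases i)
        case 0
        then show ?thesis using bd_chain_0 e by (metis max_ideal_simps(1))
      next
        case (Suc j)
        with e sub show ?thesis by (intro Cons.IH) auto
      qed
    next
      case False
      then show ?thesis
        using chains_Cons_True_Suc [OF Cons.prems(1), of e] by (simp add: bd_zero max_ideal_simps(1))
    qed
    have F: "bd cs (\<lambda>m. u ((False, e) # m)) k \<in> max_ideal E"
    proof (cases "e \<in> insert (fst c) (snd c)")
      case True
      then have "(\<lambda>m. u ((False, e) # m)) \<in> chains E cs (Suc i)"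
        using chains_Cons_False [OF Cons.prems(1), of e] by simp
      then show ?thesis using sub(1) by (rule Cons.IH)
    next
      case False
      then show ?thesis
        using chains_Cons_False [OF Cons.prems(1), of e] by (simp add: bd_zero max_ideal_simps(1))
    qed
    have "syz (fst c) (snd c) (\<lambda>a. u ((True, a) # k)) e \<in> max_ideal E"
    proof (cases "e \<in> insert (fst c) (snd c)")
      case True
      then show ?thesis
        using sub u
        by (auto simp: syz_def intro!: max_ideal_simps(3-5) polys_sum)
    next
      case False
      then show ?thesis
        using chains_Cons_True_Suc [OF Cons.prems(1), of e]
        by (simp add: syz_def max_ideal_simps(1))
    qed
    then show ?thesis using Cons x T F by (cases b) (auto intro: max_ideal_simps(2,4))
  qed (simp add: max_ideal_simps(1))
qed

subsection \<open>The resolution in coordinates\<close>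

lemma ideal_times_freeI:
  fixes I :: "('e, 'k::field) mpoly set"
  assumes "v \<in> carrier_vec b" "\<And>j. j < b \<Longrightarrow> v $ j \<in> I"
  shows "v \<in> ideal_times_free E I b"
proof -
  \<comment> \<open>Truncation to the first \<open>m\<close> coordinates: passing to
    \<open>Suc m\<close> adds one coordinate times a unit vector, which is one step of the inductive
    set.\<close>
  have "vec b (\<lambda>j. if j < m then v $ j else 0) \<in> ideal_times_free E I b" if "m \<le> b" for m
    using that
  proof (induction m)
    case 0
    have "vec b (\<lambda>j. if j < 0 then v $ j else 0) = 0\<^sub>v b" by auto
    then show ?case using ideal_times_free.zero by metis
  next
    case (Suc m)
    have "vec b (\<lambda>j. if j < Suc m then v $ j else 0) =
        v $ m \<cdot>\<^sub>v unit_vec b m + vec b (\<lambda>j. if j < m then v $ j else 0)"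
      using Suc by (auto simp: less_Suc_eq)
    moreover have "(unit_vec b m :: ('e, 'k) mpoly vec) \<in> free_module E b"
      by (auto simp: free_module_def unit_vec_def)
    moreover have "vec b (\<lambda>j. if j < m then v $ j else 0) \<in> ideal_times_free E I b" "v $ m \<in> I"
      using Suc assms(2) by simp_all
    ultimately show ?case by (simp only: ideal_times_free.add)
  qed
  from this [of b] have "vec b (\<lambda>j. if j < b then v $ j else 0) \<in> ideal_times_free E I b"
    by simp
  moreover have "vec b (\<lambda>j. if j < b then v $ j else 0) = v"
    using assms(1) by auto
  ultimately show ?thesis by simp
qed

text \<open>Numbering the cells of each degree identifies chains with vectors, and exactness and
  minimality are carried over along this identification.\<close>

theorem minimal_free_resolution_cell_ideal:
  fixes D E :: "'e set"
  assumes sep: "separated D cs" and sub: "support D cs \<subseteq> E"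
  shows "\<exists>\<epsilon> d. minimal_free_resolution E
    (Idl\<^bsub>poly_ring E\<^esub> (cell_mon D cs ` cells cs 0) :: ('e, 'k::field) mpoly set)
    (\<lambda>i. card (cells cs i)) \<epsilon> d"
proof -
  define \<beta> where "\<beta> i = card (cells cs i)" for i
  have "\<exists>h. bij_betw h {0..<\<beta> i} (cells cs i)" for i
    unfolding \<beta>_def by (rule ex_bij_betw_nat_finite [OF finite_cells [OF sep]])
  then obtain h where h: "\<And>i. bij_betw (h i) {0..<\<beta> i} (cells cs i)"
    by metis
  have h_cells: "h i j \<in> cells cs i" if "j < \<beta> i" for i j
    using bij_betwE [OF h [of i]] that by auto
  have h_eq: "h i j = h i k \<longleftrightarrow> j = k" if "j < \<beta> i" "k < \<beta> i" for i j k
    using bij_betw_imp_inj_on [OF h [of i]] that by (auto simp: inj_on_def)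
  define to_vec where "to_vec i u = vec (\<beta> i) (\<lambda>j. u (h i j))" for i and u :: "('e, 'k) chain"
  \<comment> \<open>The value zero off the cells makes this inverse to \<open>to_vec i\<close> on
    the chains of degree \<open>i\<close>.\<close>
  define of_vec where "of_vec i v =
    (\<lambda>l. if l \<in> cells cs i then v $ inv_into {0..<\<beta> i} (h i) l else 0)"
    for i and v :: "('e, 'k) mpoly vec"
  have to_vec: "to_vec i u \<in> free_module E (\<beta> i)" if "u \<in> chains E cs i" for i u
    using that by (auto simp: to_vec_def free_module_def chains_def)
  have inv_h: "inv_into {0..<\<beta> i} (h i) l < \<beta> i" "h i (inv_into {0..<\<beta> i} (h i) l) = l"
    if "l \<in> cells cs i" for i l
    using that bij_betw_imp_surj_on [OF h [of i]]
      inv_into_into [of l "h i" "{0..<\<beta> i}"] f_inv_into_f [of l "h i" "{0..<\<beta> i}"] by auto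
  have of_vec: "of_vec i v \<in> chains E cs i" if "v \<in> free_module E (\<beta> i)" for i v
    using that inv_h(1) by (auto simp: of_vec_def free_module_def chains_def)
  have to_of: "to_vec i (of_vec i v) = v" if "v \<in> free_module E (\<beta> i)" for i v
    using that h_cells bij_betw_inv_into_left [OF h [of i]]
    by (auto simp: to_vec_def of_vec_def free_module_def)
  have of_to: "of_vec i (to_vec i u) = u" if "u \<in> chains E cs i" for i u
    using that inv_h by (fastforce simp: to_vec_def of_vec_def chains_def)
  have to_vec_0: "to_vec i (\<lambda>l. 0) = 0\<^sub>v (\<beta> i)" for i
    by (auto simp: to_vec_def)
  have to_vec_eq_0: "u = (\<lambda>l. 0)" if "u \<in> chains E cs i" "to_vec i u = 0\<^sub>v (\<beta> i)" for i u
    using that of_to [of u i] of_to [OF chains_zero, of i] to_vec_0 [of i] by metis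
  have free_image: "free_module E (\<beta> i) = to_vec i ` chains E cs i" for i
    using to_vec of_vec to_of by (metis (no_types, lifting) image_eqI image_subsetI subsetI subset_antisym)
  \<comment> \<open>The columns are the boundaries of the chains that are one at a single cell and
    zero elsewhere.\<close>
  define d where "d i = mat (\<beta> i) (\<beta> (Suc i))
    (\<lambda>(r, c). bd cs (\<lambda>l. if l = h (Suc i) c then 1 else 0 :: ('e, 'k) mpoly) (h i r))" for i
  define \<epsilon> where "\<epsilon> = vec (\<beta> 0) (\<lambda>j. cell_mon D cs (h 0 j) :: ('e, 'k) mpoly)"
  have d: "d i *\<^sub>v to_vec (Suc i) u = to_vec i (bd cs u)" if u: "u \<in> chains E cs (Suc i)" for i u
  proof (rule eq_vecI)
    fix r assume "r < dim_vec (to_vec i (bd cs u))"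
    then have r: "r < \<beta> i" by (simp add: to_vec_def)
    \<comment> \<open>Expanding \<open>u\<close> in these unit chains turns linearity of
      \<open>bd\<close> into the matrix product.\<close>
    have "u = (\<lambda>l. \<Sum>c = 0..<\<beta> (Suc i). u (h (Suc i) c) * (if l = h (Suc i) c then 1 else 0))"
    proof
      fix l
      show "u l = (\<Sum>c = 0..<\<beta> (Suc i). u (h (Suc i) c) * (if l = h (Suc i) c then 1 else 0))"
      proof (cases "l \<in> cells cs (Suc i)")
        case True
        then obtain j where j: "j < \<beta> (Suc i)" "l = h (Suc i) j" using inv_h by metis
        have "(\<Sum>c = 0..<\<beta> (Suc i). u (h (Suc i) c) * (if l = h (Suc i) c then 1 else 0)) =
            (\<Sum>c = 0..<\<beta> (Suc i). if j = c then u (h (Suc i) c) else 0)"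
          using j h_eq by (intro sum.cong) auto
        then show ?thesis using j by simp
      next
        case False
        then have "l \<noteq> h (Suc i) c" if "c < \<beta> (Suc i)" for c using h_cells that by metis
        then show ?thesis using False u by (simp add: chains_def)
      qed
    qed
    then have "bd cs u (h i r) = bd cs (\<lambda>l. \<Sum>c = 0..<\<beta> (Suc i).
        u (h (Suc i) c) * (if l = h (Suc i) c then 1 else 0)) (h i r)"
      by (rule arg_cong)
    also have "\<dots> = (\<Sum>c = 0..<\<beta> (Suc i). u (h (Suc i) c) *
        bd cs (\<lambda>l. if l = h (Suc i) c then 1 else 0) (h i r))"
      by (simp only: bd_sum bd_scale)
    finally show "(d i *\<^sub>v to_vec (Suc i) u) $ r = to_vec i (bd cs u) $ r"
      using r by (simp add: d_def to_vec_def scalar_prod_def mult.commute)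
  qed (simp add: d_def to_vec_def)
  have d_image: "(*\<^sub>v) (d i) ` free_module E (\<beta> (Suc i)) =
      (\<lambda>u. to_vec i (bd cs u)) ` chains E cs (Suc i)" for i
    unfolding free_image image_image using d by (intro image_cong) auto
  have \<epsilon>: "to_vec 0 u \<bullet> \<epsilon> = aug D cs u" for u
    using sum.reindex_bij_betw [OF h [of 0], of "\<lambda>l. u l * cell_mon D cs l"]
    by (simp add: \<epsilon>_def to_vec_def scalar_prod_def aug_def)
  have unit: "(\<lambda>l. if l = h i c then 1 else 0 :: ('e, 'k) mpoly) \<in> chains E cs i" if "c < \<beta> i" for i c
    using h_cells [OF that] by (auto simp: chains_def)
  have "free_resolution E (Idl\<^bsub>poly_ring E\<^esub> (cell_mon D cs ` cells cs 0)) \<beta> \<epsilon> d"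
    unfolding free_resolution_def
  proof (intro conjI allI)
    show "\<epsilon> \<in> free_module E (\<beta> 0)"
      using cell_mon_polys [OF sub] by (auto simp: \<epsilon>_def free_module_def)
    show "d i \<in> free_map E (\<beta> i) (\<beta> (Suc i))" for i
      using bd_chains [OF unit sub]
      by (auto simp: d_def free_map_def elements_mat_def chains_def)
    show "(\<lambda>v. v \<bullet> \<epsilon>) ` free_module E (\<beta> 0) = Idl\<^bsub>poly_ring E\<^esub> (cell_mon D cs ` cells cs 0)"
      by (simp add: free_image image_image \<epsilon> image_aug [OF sep sub])
    show "{v \<in> free_module E (\<beta> 0). v \<bullet> \<epsilon> = 0} = (*\<^sub>v) (d 0) ` free_module E (\<beta> 1)"
    proof (intro equalityI subsetI)
      fix v assume "v \<in> {v \<in> free_module E (\<beta> 0). v \<bullet> \<epsilon> = 0}"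
      then obtain u where u: "u \<in> chains E cs 0" "v = to_vec 0 u" "aug D cs u = 0"
        by (auto simp: free_image \<epsilon>)
      then obtain w where "w \<in> chains E cs 1" "u = bd cs w"
        using aug_exact [OF sep sub] by metis
      then show "v \<in> (*\<^sub>v) (d 0) ` free_module E (\<beta> 1)"
        using u d_image [of 0] by auto
    next
      fix v assume "v \<in> (*\<^sub>v) (d 0) ` free_module E (\<beta> 1)"
      then obtain w where "w \<in> chains E cs 1" "v = to_vec 0 (bd cs w)"
        using d_image [of 0] by auto
      then show "v \<in> {v \<in> free_module E (\<beta> 0). v \<bullet> \<epsilon> = 0}"
        using bd_chains [of w E cs 0, OF _ sub] aug_bd [OF sep, of w] by (auto simp: free_image \<epsilon>)
    qed
    show "{v \<in> free_module E (\<beta> (Suc i)). d i *\<^sub>v v = 0\<^sub>v (\<beta> i)} =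
        (*\<^sub>v) (d (Suc i)) ` free_module E (\<beta> (Suc (Suc i)))" for i
    proof (intro equalityI subsetI)
      fix v assume "v \<in> {v \<in> free_module E (\<beta> (Suc i)). d i *\<^sub>v v = 0\<^sub>v (\<beta> i)}"
      then obtain u where u: "u \<in> chains E cs (Suc i)" "v = to_vec (Suc i) u"
          "to_vec i (bd cs u) = 0\<^sub>v (\<beta> i)"
        using d by (auto simp: free_image)
      then have "bd cs u = (\<lambda>l. 0)" using to_vec_eq_0 bd_chains sub by metis
      then obtain w where "w \<in> chains E cs (Suc (Suc i))" "u = bd cs w"
        using bd_exact [OF sep sub u(1)] by metis
      then show "v \<in> (*\<^sub>v) (d (Suc i)) ` free_module E (\<beta> (Suc (Suc i)))"
        using u d_image [of "Suc i"] by auto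
    next
      fix v assume "v \<in> (*\<^sub>v) (d (Suc i)) ` free_module E (\<beta> (Suc (Suc i)))"
      then obtain w where w: "w \<in> chains E cs (Suc (Suc i))" "v = to_vec (Suc i) (bd cs w)"
        using d_image [of "Suc i"] by auto
      have "bd cs (bd cs w) = (\<lambda>l. 0)" by (simp add: bd_bd fun_eq_iff)
      then show "v \<in> {v \<in> free_module E (\<beta> (Suc i)). d i *\<^sub>v v = 0\<^sub>v (\<beta> i)}"
        using w bd_chains [OF w(1) sub] d [of "bd cs w" i] by (auto simp: free_image to_vec_0)
    qed
  qed
  moreover have "(*\<^sub>v) (d i) ` free_module E (\<beta> (Suc i)) \<subseteq>
      ideal_times_free E (max_ideal E) (\<beta> i)" for i
  proof
    fix v assume "v \<in> (*\<^sub>v) (d i) ` free_module E (\<beta> (Suc i))"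
    then obtain u where "u \<in> chains E cs (Suc i)" "v = to_vec i (bd cs u)"
      using d_image [of i] by auto
    then show "v \<in> ideal_times_free E (max_ideal E) (\<beta> i)"
      using bd_in_max_ideal [OF _ sub] by (intro ideal_times_freeI) (auto simp: to_vec_def)
  qed
  ultimately show ?thesis
    unfolding minimal_free_resolution_def \<beta>_def by blast
qed

section \<open>Betti numbers\<close>

text \<open>A cell has one entry for each cycle, hence at most \<open>length cs\<close>
  syzygies.\<close>

lemma cells_eq_empty: "length cs < i \<Longrightarrow> cells cs i = {}"
  by (induction cs arbitrary: i) auto

text \<open>Putting a cycle in front multiplies the generating function by a linear polynomial: a
  generator keeps the degree and a syzygy raises it by one.\<close>

lemma card_cells:
  assumes "separated D cs"
  shows "int (card (cells cs i)) =
    coeff (\<Prod>c\<leftarrow>cs. [:int (card (insert (fst c) (snd c))), int (card (snd c)):]) i"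
  using assms
proof (induction cs arbitrary: i)
  case Nil
  then show ?case by (simp add: coeff_pCons split: nat.split)
next
  case (Cons c cs)
  have fin: "finite (snd c)" "finite (cells cs j)" for j
    using Cons.prems finite_cells by auto
  let ?F = "(\<lambda>(e, l). (False, e) # l) ` (insert (fst c) (snd c) \<times> cells cs i)"
  have F: "card ?F = card (insert (fst c) (snd c)) * card (cells cs i)"
    by (subst card_image) (auto simp: inj_on_def card_cartesian_product)
  show ?case
  proof (cases i)
    case 0
    then show ?thesis using F Cons by (simp add: algebra_simps)
  next
    case (Suc j)
    let ?T = "(\<lambda>(a, l). (True, a) # l) ` (snd c \<times> cells cs j)"
    have T: "card ?T = card (snd c) * card (cells cs j)"
      by (subst card_image) (auto simp: inj_on_def card_cartesian_product)
    have "card (cells (c # cs) i) = card ?F + card ?T"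
      using fin Suc by (simp only: cells.simps) (subst card_Un_disjoint; auto)
    then show ?thesis using F T Suc Cons by (simp add: algebra_simps)
  qed
qed

text \<open>Expand the product of the sums \<open>n k * (1 + x) + (- x)\<close> over the sets
  \<open>A\<close> of indices at which the first summand is taken. The other
  \<open>t - card A\<close> factors contribute a sign and a shift of the degree, and the power of
  \<open>1 + x\<close> contributes a binomial coefficient.\<close>

lemma coeff_prod_elem_sym:
  fixes n :: "nat \<Rightarrow> nat"
  assumes "i \<le> t"
  shows "coeff (\<Prod>k\<in>{1..t}. [:int (n k), int (n k) - 1:]) i =
    (\<Sum>j=0..i. (- 1) ^ j * int ((t - j) choose (i - j)) * int (elem_sym n t (t - j)))"
proof -
  have coeff_1: "coeff ([:1, 1:] ^ m) i = int (m choose i)" for m i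
    using coeff_linear_poly_power [of i m "1::int" 1]
    by (cases "i \<le> m") (auto intro!: coeff_eq_0 simp: degree_power_eq binomial_eq_0)
  have "(\<Prod>k\<in>{1..t}. [:int (n k), int (n k) - 1:]) =
      (\<Prod>k\<in>{1..t}. [:int (n k):] * [:1, 1:] + monom (- 1) 1)"
    by (intro prod.cong) (auto simp: monom_altdef)
  also have "\<dots> = (\<Sum>A\<in>Pow {1..t}. (\<Prod>k\<in>A. [:int (n k):] * [:1, 1:]) *
      (\<Prod>k\<in>{1..t} - A. monom (- 1) 1))"
    by (rule prod_add) simp
  also have "\<dots> = (\<Sum>A\<in>Pow {1..t}. monom ((- 1) ^ (t - card A)) (t - card A) *
      smult (\<Prod>k\<in>A. int (n k)) ([:1, 1:] ^ card A))"
  proof (intro sum.cong refl)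
    fix A assume A: "A \<in> Pow {1..t}"
    have const: "(\<Prod>k\<in>A. [:int (n k):]) = [:\<Prod>k\<in>A. int (n k):]"
      by (induction A rule: infinite_finite_induct) (simp_all add: one_pCons)
    have "card ({1..t} - A) = t - card A"
      using A by (subst card_Diff_subset) (auto intro: finite_subset)
    then show "(\<Prod>k\<in>A. [:int (n k):] * [:1, 1:]) * (\<Prod>k\<in>{1..t} - A. monom (- 1) 1) =
        monom ((- 1) ^ (t - card A)) (t - card A) *
        smult (\<Prod>k\<in>A. int (n k)) ([:1, 1:] ^ card A)"
      unfolding prod.distrib const by (simp add: monom_power mult.commute)
  qed
  finally have "coeff (\<Prod>k\<in>{1..t}. [:int (n k), int (n k) - 1:]) i =
      (\<Sum>A\<in>Pow {1..t}. if i < t - card A then 0 else (- 1) ^ (t - card A) *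
        ((\<Prod>k\<in>A. int (n k)) * int (card A choose (i - (t - card A)))))"
    by (auto simp: coeff_sum coeff_monom_mult coeff_1 intro!: sum.cong)
  \<comment> \<open>Grouping by the number \<open>j\<close> of indices outside \<open>A\<close>
    makes the inner sum an elementary symmetric polynomial of index \<open>t - j\<close>.\<close>
  also have "\<dots> = (\<Sum>j\<in>{0..t}. \<Sum>A\<in>{A \<in> Pow {1..t}. t - card A = j}.
      if i < t - card A then 0 else (- 1) ^ (t - card A) *
        ((\<Prod>k\<in>A. int (n k)) * int (card A choose (i - (t - card A)))))"
    by (rule sum.group [symmetric]) auto
  also have "\<dots> = (\<Sum>j\<in>{0..t}. if i < j then 0 else
      (- 1) ^ j * int ((t - j) choose (i - j)) * int (elem_sym n t (t - j)))"
  proof (intro sum.cong refl)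
    fix j assume j: "j \<in> {0..t}"
    have "card A \<le> t" if "A \<subseteq> {1..t}" for A
      using card_mono [OF _ that] by simp
    then have sets: "{A \<in> Pow {1..t}. t - card A = j} = {A. A \<subseteq> {1..t} \<and> card A = t - j}"
      using j by fastforce
    show "(\<Sum>A\<in>{A \<in> Pow {1..t}. t - card A = j}.
        if i < t - card A then 0 else (- 1) ^ (t - card A) *
          ((\<Prod>k\<in>A. int (n k)) * int (card A choose (i - (t - card A))))) =
        (if i < j then 0 else
          (- 1) ^ j * int ((t - j) choose (i - j)) * int (elem_sym n t (t - j)))"
      unfolding sets elem_sym_def of_nat_sum of_nat_prod sum_distrib_left
      using j by (auto intro!: sum.cong sum.neutral simp: sum_distrib_left mult_ac)
  qed
  also have "\<dots> = (\<Sum>j\<in>{0..i}. if i < j then 0 else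
      (- 1) ^ j * int ((t - j) choose (i - j)) * int (elem_sym n t (t - j)))"
    using assms by (intro sum.mono_neutral_right) auto
  also have "\<dots> = (\<Sum>j=0..i. (- 1) ^ j * int ((t - j) choose (i - j)) * int (elem_sym n t (t - j)))"
    by (intro sum.cong) auto
  finally show ?thesis .
qed

section \<open>Cycles in a cactus graph\<close>

abbreviation adjacency :: "('v, 'e) graph \<Rightarrow> ('v \<times> 'v) set" where
  "adjacency G \<equiv> {(a, b). \<exists>e\<in>edges G. ends G e = {a, b}}"

lemma sym_rtrancl_adjacency: "(u, v) \<in> (adjacency G)\<^sup>* \<Longrightarrow> (v, u) \<in> (adjacency G)\<^sup>*"
proof -
  have "sym (adjacency G)" by (auto simp: sym_def insert_commute)
  then show "(u, v) \<in> (adjacency G)\<^sup>* \<Longrightarrow> (v, u) \<in> (adjacency G)\<^sup>*"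
    by (meson sym_rtrancl symD)
qed

lemma connected_graphI:
  assumes "r \<in> verts G" "\<And>u. u \<in> verts G \<Longrightarrow> (r, u) \<in> (adjacency G)\<^sup>*"
  shows "connected_graph G"
proof -
  have "(u, v) \<in> (adjacency G)\<^sup>*" if "u \<in> verts G" "v \<in> verts G" for u v
    using sym_rtrancl_adjacency [OF assms(2) [OF that(1)]] assms(2) [OF that(2)]
    by (rule rtrancl_trans)
  then show ?thesis using assms(1) by (auto simp: connected_graph_def)
qed

lemma connected_graphD:
  "connected_graph G \<Longrightarrow> u \<in> verts G \<Longrightarrow> v \<in> verts G \<Longrightarrow> (u, v) \<in> (adjacency G)\<^sup>*"
  by (simp add: connected_graph_def)

lemma finite_graph_ends: "finite_graph G \<Longrightarrow> e \<in> edges G \<Longrightarrow> ends G e \<subseteq> verts G"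
  by (simp add: finite_graph_def)

lemma finite_graph_ends_nonempty: "finite_graph G \<Longrightarrow> e \<in> edges G \<Longrightarrow> ends G e \<noteq> {}"
  by (force simp: finite_graph_def)

lemma subgraph_trans: "subgraph A B \<Longrightarrow> subgraph B C \<Longrightarrow> subgraph A C"
  by (auto simp: subgraph_def)

section \<open>Cycles: cyclic indices, nonseparability, minimality\<close>

lemma cyclic_induct:
  fixes n :: nat
  assumes "i < n" "P i" "\<And>k. k < n \<Longrightarrow> P k \<Longrightarrow> P ((k + 1) mod n)" "k < n"
  shows "P k"
proof -
  have "P ((i + m) mod n)" for m
  proof (induction m)
    case (Suc m)
    have "P (((i + m) mod n + 1) mod n)" using assms Suc by simp
    then show ?case by (simp add: mod_Suc_eq)
  qed (use assms in simp)
  \<comment> \<open>From \<open>i\<close>, going \<open>n - i + k\<close> steps leads to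
    \<open>k\<close> after one extra turn; the turn keeps the difference of indices
    nonnegative.\<close>
  from this [of "n - i + k"] show ?thesis using assms by simp
qed

lemma inj_Suc_mod:
  fixes n :: nat
  assumes "i < n" "j < n" "(i + 1) mod n = (j + 1) mod n"
  shows "i = j"
  using assms by (auto simp: mod_Suc split: if_splits)

text \<open>Going around the cycle, the edges change from \<open>H1\<close> to \<open>H2\<close>
  somewhere and back somewhere else. Both changes take place at a common vertex of the two sides,
  hence at \<open>v\<close>. As the vertices are distinct, the two places agree, although one is
  followed by an edge of \<open>H2\<close> and the other by an edge of \<open>H1\<close>.\<close>

lemma nonseparable_cycle:
  assumes "is_cycle H"
  shows "nonseparable H"
proof -
  obtain n vs es where n: "n \<ge> 1" "length vs = n" "length es = n" "distinct vs"
    and H: "verts H = set vs" "edges H = set es"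
    and es: "\<And>i. i < n \<Longrightarrow> ends H (es ! i) = {vs ! i, vs ! ((i + 1) mod n)}"
    using assms unfolding is_cycle_def cycle_of_length_def by blast
  have "connected_graph H"
  proof (rule connected_graphI)
    show "vs ! 0 \<in> verts H" using n H by simp
    have path: "(vs ! 0, vs ! i) \<in> (adjacency H)\<^sup>*" if "i < n" for i
      using that
    proof (induction i)
      case (Suc i)
      then have "es ! i \<in> edges H" "ends H (es ! i) = {vs ! i, vs ! Suc i}"
        using n H es [of i] by simp_all
      then have "(vs ! i, vs ! Suc i) \<in> adjacency H" by blast
      then show ?case using Suc by (meson Suc_lessD rtrancl.rtrancl_into_rtrancl)
    qed simp
    show "(vs ! 0, u) \<in> (adjacency H)\<^sup>*" if u: "u \<in> verts H" for u
    proof -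
      obtain i where "i < n" "u = vs ! i"
        using u n H in_set_conv_nth [of u vs] by auto
      then show ?thesis using path by simp
    qed
  qed
  moreover have "\<not> separable H"
  proof
    assume "separable H"
    then obtain H1 H2 v where s: "subgraph H1 H" "subgraph H2 H"
      and ne: "edges H1 \<noteq> {}" "edges H2 \<noteq> {}"
      and un: "edges H1 \<union> edges H2 = edges H" "edges H1 \<inter> edges H2 = {}"
      and v: "verts H1 \<inter> verts H2 = {v}"
      unfolding separable_def by blast
    have ends1: "ends H e \<subseteq> verts H1" if "e \<in> edges H1" for e
      using that s(1) finite_graph_ends unfolding subgraph_def by metis
    have ends2: "ends H e \<subseteq> verts H2" if "e \<in> edges H2" for e
      using that s(2) finite_graph_ends unfolding subgraph_def by metis
    have mem: "es ! k \<in> edges H1 \<longleftrightarrow> es ! k \<notin> edges H2" if "k < n" for k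
    proof -
      have "es ! k \<in> edges H" using that n H by simp
      then show ?thesis using un by blast
    qed
    have idx: "\<exists>k<n. e = es ! k" if "e \<in> edges H" for e
      using that n H by (metis in_set_conv_nth)
    have suc: "(k + 1) mod n < n" for k using n by simp
    obtain d1 d2 where "d1 \<in> edges H1" "d2 \<in> edges H2" using ne by blast
    moreover from this have "d1 \<in> edges H" "d2 \<in> edges H" using un(1) by blast+
    ultimately obtain a b where a: "a < n" "es ! a \<in> edges H1" and b: "b < n" "es ! b \<in> edges H2"
      using idx [of d1] idx [of d2] by auto
    have "\<exists>i<n. es ! i \<in> edges H1 \<and> es ! ((i + 1) mod n) \<notin> edges H1"
      using cyclic_induct [of a n "\<lambda>k. es ! k \<in> edges H1" b] a b mem [OF b(1)] by blast
    then obtain i where i: "i < n" "es ! i \<in> edges H1" "es ! ((i + 1) mod n) \<in> edges H2"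
      using mem suc by blast
    have "\<exists>j<n. es ! j \<in> edges H2 \<and> es ! ((j + 1) mod n) \<notin> edges H2"
      using cyclic_induct [of b n "\<lambda>k. es ! k \<in> edges H2" a] a b mem [OF a(1)] by blast
    then obtain j where j: "j < n" "es ! j \<in> edges H2" "es ! ((j + 1) mod n) \<in> edges H1"
      using mem suc by blast
    have "vs ! ((i + 1) mod n) = v"
      using es [OF i(1)] es [OF suc [of i]] ends1 [OF i(2)] ends2 [OF i(3)] v by auto
    moreover have "vs ! ((j + 1) mod n) = v"
      using es [OF j(1)] es [OF suc [of j]] ends2 [OF j(2)] ends1 [OF j(3)] v by auto
    ultimately have "(i + 1) mod n = (j + 1) mod n"
      using n suc nth_eq_iff_index_eq by metis
    then show False using i(3) j(3) mem suc by metis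
  qed
  ultimately show ?thesis by (simp add: nonseparable_def)
qed

text \<open>A vertex lies on the edge that leaves it and on the edge that enters it, and these
  coincide only for a loop. This is the form of having degree two that also covers cycles of length
  one and two.\<close>

lemma cycle_other_edge:
  assumes "is_cycle H" "w \<in> verts H"
  shows "(\<exists>e'\<in>edges H. e' \<noteq> e \<and> w \<in> ends H e') \<or> ends H e = {w}"
proof -
  obtain n vs es where n: "n \<ge> 1" "length vs = n" "length es = n" "distinct es"
    and H: "verts H = set vs" "edges H = set es"
    and es: "\<And>i. i < n \<Longrightarrow> ends H (es ! i) = {vs ! i, vs ! ((i + 1) mod n)}"
    using assms(1) unfolding is_cycle_def cycle_of_length_def by blast
  obtain i where i: "i < n" "w = vs ! i"
    using assms(2) n H by (metis in_set_conv_nth)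
  \<comment> \<open>The index of the entering edge; adding \<open>n\<close> keeps the subtraction
    from being truncated at \<open>i = 0\<close>.\<close>
  define p where "p = (i + n - 1) mod n"
  have p: "p < n" "(p + 1) mod n = i"
    using n i by (auto simp: p_def mod_Suc_eq)
  have w: "w \<in> ends H (es ! i)" "w \<in> ends H (es ! p)"
    using es [OF i(1)] es [OF p(1)] i p by auto
  have mem: "es ! i \<in> edges H" "es ! p \<in> edges H" using n H i p by auto
  show ?thesis
  proof (cases "es ! i = e \<and> es ! p = e")
    case True
    then have "i = p" using n i p nth_eq_iff_index_eq by metis
    then show ?thesis using es [OF i(1)] p i True by auto
  next
    case False
    then show ?thesis using w mem by blast
  qed
qed

lemma cycle_edges_nonempty: "is_cycle H \<Longrightarrow> edges H \<noteq> {}"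
  by (force simp: is_cycle_def cycle_of_length_def)

text \<open>At the head of one of its edges \<open>H\<close> has a further edge, and
  \<open>K\<close> offers only the cyclic successor there. So the edges of \<open>H\<close> are
  closed under successor and exhaust \<open>K\<close>.\<close>

lemma cycle_subgraph_cycle_eq:
  assumes "subgraph H K" "is_cycle H" "is_cycle K"
  shows "H = K"
proof -
  obtain n vs es where n: "n \<ge> 1" "length vs = n" "length es = n" "distinct vs"
    and K: "verts K = set vs" "edges K = set es"
    and es: "\<And>i. i < n \<Longrightarrow> ends K (es ! i) = {vs ! i, vs ! ((i + 1) mod n)}"
    using assms(3) unfolding is_cycle_def cycle_of_length_def by blast
  have sub: "finite_graph H" "verts H \<subseteq> verts K" "edges H \<subseteq> edges K" "ends H = ends K"
    using assms(1) by (auto simp: subgraph_def)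
  have suc: "(k + 1) mod n < n" for k using n by simp
  have step: "es ! ((k + 1) mod n) \<in> edges H" if k: "k < n" "es ! k \<in> edges H" for k
  proof -
    define w where "w = vs ! ((k + 1) mod n)"
    have "w \<in> ends H (es ! k)" using es [OF k(1)] sub by (auto simp: w_def)
    then have "w \<in> verts H" using finite_graph_ends [OF sub(1) k(2)] by blast
    then consider e' where "e' \<in> edges H" "e' \<noteq> es ! k" "w \<in> ends H e'" | "ends H (es ! k) = {w}"
      using cycle_other_edge [OF assms(2)] by blast
    then show ?thesis
    proof cases
      case 1
      then obtain m where m: "m < n" "e' = es ! m"
        using sub(3) n K by (metis in_set_conv_nth subsetD)
      then have "w = vs ! m \<or> w = vs ! ((m + 1) mod n)"
        using 1 es sub(4) by auto
      then have "(k + 1) mod n = m \<or> (k + 1) mod n = (m + 1) mod n"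
        using n m suc nth_eq_iff_index_eq unfolding w_def by metis
      then show ?thesis using 1 m k inj_Suc_mod by metis
    next
      \<comment> \<open>The edge is a loop, so distinctness of \<open>vs\<close> makes
        \<open>k\<close> its own successor.\<close>
      case 2
      then have "vs ! k = vs ! ((k + 1) mod n)"
        using es [OF k(1)] sub(4) by (auto simp: w_def)
      then have "k = (k + 1) mod n"
        using n k suc nth_eq_iff_index_eq by metis
      then show ?thesis using k by metis
    qed
  qed
  obtain e where "e \<in> edges H" using cycle_edges_nonempty [OF assms(2)] by blast
  then obtain i where "i < n" "es ! i \<in> edges H"
    using sub(3) n K by (metis in_set_conv_nth subsetD)
  then have all: "es ! k \<in> edges H" if "k < n" for k
    using cyclic_induct [of i n "\<lambda>k. es ! k \<in> edges H" k] step that by blast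
  then have "edges K \<subseteq> edges H"
    using n K by (auto simp: in_set_conv_nth)
  moreover have "verts K \<subseteq> verts H"
  proof
    fix v assume "v \<in> verts K"
    then obtain k where k: "k < n" "v = vs ! k" using n K by (metis in_set_conv_nth)
    then have "v \<in> ends H (es ! k)" using es sub(4) by auto
    then show "v \<in> verts H" using finite_graph_ends [OF sub(1) all [OF k(1)]] by blast
  qed
  ultimately show ?thesis using sub by (intro graph.equality) auto
qed

text \<open>Otherwise the separation would restrict to \<open>B\<close>: paths in \<open>B\<close>
  change sides only at \<open>v\<close>, so \<open>v\<close> lies in \<open>B\<close> and the part
  of \<open>B\<close> on either side is connected through \<open>v\<close>.\<close>

lemma nonseparable_within_separation:
  assumes B: "subgraph B H" "nonseparable B"
    and s: "subgraph H1 H" "subgraph H2 H"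
    and un: "edges H1 \<union> edges H2 = edges H" "edges H1 \<inter> edges H2 = {}"
    and v: "verts H1 \<union> verts H2 = verts H" "verts H1 \<inter> verts H2 = {v}"
  shows "edges B \<inter> edges H1 = {} \<or> edges B \<inter> edges H2 = {}"
proof (rule ccontr)
  assume neg: "\<not> ?thesis"
  have eq: "ends H1 = ends B" "ends H2 = ends B"
    and fin: "finite_graph B" "finite_graph H1" "finite_graph H2"
    and sub: "verts B \<subseteq> verts H" "edges B \<subseteq> edges H"
    using B s by (auto simp: subgraph_def)
  have conn: "connected_graph B" using B by (simp add: nonseparable_def)
  have endsB: "ends B e \<subseteq> verts B" if "e \<in> edges B" for e
    using that fin finite_graph_ends by metis
  have ends1: "ends B e \<subseteq> verts H1" if "e \<in> edges H1" for e
    using that fin finite_graph_ends eq by metis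
  have ends2: "ends B e \<subseteq> verts H2" if "e \<in> edges H2" for e
    using that fin finite_graph_ends eq by metis
  have side1: "e \<in> edges H1" if "e \<in> edges B" "x \<in> ends B e" "x \<in> verts H1" "x \<noteq> v" for e x
    using that ends2 un v sub by blast
  have side2: "e \<in> edges H2" if "e \<in> edges B" "x \<in> ends B e" "x \<in> verts H2" "x \<noteq> v" for e x
    using that ends1 un v sub by blast
  obtain e1 e2 where e1: "e1 \<in> edges B" "e1 \<in> edges H1" and e2: "e2 \<in> edges B" "e2 \<in> edges H2"
    using neg by blast
  obtain x1 where x1: "x1 \<in> ends B e1" using finite_graph_ends_nonempty [OF fin(1) e1(1)] by blast
  obtain x2 where x2: "x2 \<in> ends B e2" using finite_graph_ends_nonempty [OF fin(1) e2(1)] by blast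
  \<comment> \<open>If \<open>B\<close> avoided \<open>v\<close>, a path starting in
    \<open>H1\<close> could never leave it, yet it reaches the end \<open>x2\<close> of an edge of
    \<open>H2\<close>.\<close>
  have vB: "v \<in> verts B"
  proof (rule ccontr)
    assume nv: "v \<notin> verts B"
    have "(x1, x2) \<in> (adjacency B)\<^sup>*"
      using conn x1 x2 e1 e2 endsB by (intro connected_graphD) auto
    then have "x2 \<in> verts H1"
    proof (induction rule: rtrancl_induct)
      case base
      then show ?case using x1 e1 ends1 by blast
    next
      case (step y z)
      then obtain e where e: "e \<in> edges B" "ends B e = {y, z}" by blast
      then have "y \<in> verts B" using endsB by blast
      then have "e \<in> edges H1" using side1 [of e y] e step nv by blast
      then show ?case using ends1 e by blast
    qed
    then have "x2 = v" using x2 e2 ends2 v by blast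
    then show False using nv x2 e2 endsB by blast
  qed
  let ?B1 = "\<lparr>verts = verts B \<inter> verts H1, edges = edges B \<inter> edges H1, ends = ends B\<rparr>"
  let ?B2 = "\<lparr>verts = verts B \<inter> verts H2, edges = edges B \<inter> edges H2, ends = ends B\<rparr>"
  have sub1: "subgraph ?B1 B"
    using fin endsB ends1 by (auto simp: subgraph_def finite_graph_def)
  have sub2: "subgraph ?B2 B"
    using fin endsB ends2 by (auto simp: subgraph_def finite_graph_def)
  have c1: "connected_graph ?B1"
  proof (rule connected_graphI [of v])
    show "v \<in> verts ?B1" using vB v by auto
    fix u assume u: "u \<in> verts ?B1"
    then have "(u, v) \<in> (adjacency B)\<^sup>*" using conn vB by (intro connected_graphD) auto
    moreover have "u \<in> verts H1" using u by simp
    \<comment> \<open>The path is followed only up to its first visit to \<open>v\<close>; until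
      then all of its edges belong to \<open>H1\<close>.\<close>
    ultimately have "(u, v) \<in> (adjacency ?B1)\<^sup>*"
    proof (induction rule: converse_rtrancl_induct)
      case (step y z)
      obtain e where e: "e \<in> edges B" "ends B e = {y, z}" using step by blast
      show ?case
      proof (cases "y = v")
        case False
        then have "e \<in> edges H1" using side1 [of e y] e step by blast
        then have "(y, z) \<in> adjacency ?B1" "z \<in> verts H1" using e ends1 [of e] by auto
        then show ?thesis using step.IH by (meson converse_rtrancl_into_rtrancl)
      qed simp
    qed simp
    then show "(v, u) \<in> (adjacency ?B1)\<^sup>*" by (rule sym_rtrancl_adjacency)
  qed
  have c2: "connected_graph ?B2"
  proof (rule connected_graphI [of v])
    show "v \<in> verts ?B2" using vB v by auto
    fix u assume u: "u \<in> verts ?B2"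
    then have "(u, v) \<in> (adjacency B)\<^sup>*" using conn vB by (intro connected_graphD) auto
    moreover have "u \<in> verts H2" using u by simp
    ultimately have "(u, v) \<in> (adjacency ?B2)\<^sup>*"
    proof (induction rule: converse_rtrancl_induct)
      case (step y z)
      obtain e where e: "e \<in> edges B" "ends B e = {y, z}" using step by blast
      show ?case
      proof (cases "y = v")
        case False
        then have "e \<in> edges H2" using side2 [of e y] e step by blast
        then have "(y, z) \<in> adjacency ?B2" "z \<in> verts H2" using e ends2 [of e] by auto
        then show ?thesis using step.IH by (meson converse_rtrancl_into_rtrancl)
      qed simp
    qed simp
    then show "(v, u) \<in> (adjacency ?B2)\<^sup>*" by (rule sym_rtrancl_adjacency)
  qed
  have "separable B"
    unfolding separable_def
    by (rule exI [of _ ?B1], rule exI [of _ ?B2], rule exI [of _ v])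
      (use sub1 sub2 c1 c2 e1 e2 un v vB sub in auto)
  then show False using B by (simp add: nonseparable_def)
qed

text \<open>In a separation of the union, each of \<open>A\<close> and \<open>B\<close> has all its
  edges on one side. The common edge makes it the same side, and the other side is left without
  edges.\<close>

lemma nonseparable_union:
  assumes "subgraph A G" "subgraph B G" "nonseparable A" "nonseparable B"
    and e: "e \<in> edges A" "e \<in> edges B"
  obtains U where "subgraph U G" "nonseparable U" "subgraph A U" "subgraph B U"
proof -
  define U where "U = \<lparr>verts = verts A \<union> verts B, edges = edges A \<union> edges B, ends = ends G\<rparr>"
  have "finite_graph U"
    using assms(1,2) by (auto simp: U_def subgraph_def finite_graph_def; blast)
  then have U: "subgraph U G" "subgraph A U" "subgraph B U"
    using assms(1,2) by (auto simp: U_def subgraph_def)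
  obtain x where "x \<in> ends G e"
    using e assms(1) finite_graph_ends_nonempty unfolding subgraph_def by (metis ex_in_conv)
  then have x: "x \<in> verts A" "x \<in> verts B"
    using e assms(1,2) finite_graph_ends unfolding subgraph_def by (metis subsetD)+
  have "adjacency A \<subseteq> adjacency U" "adjacency B \<subseteq> adjacency U"
    using assms(1,2) by (auto simp: U_def subgraph_def)
  then have adj: "(adjacency A)\<^sup>* \<subseteq> (adjacency U)\<^sup>*" "(adjacency B)\<^sup>* \<subseteq> (adjacency U)\<^sup>*"
    by (simp_all add: rtrancl_mono)
  have conn: "connected_graph A" "connected_graph B"
    using assms by (auto simp: nonseparable_def)
  have "connected_graph U"
  proof (rule connected_graphI)
    show "x \<in> verts U" using x by (simp add: U_def)
    show "(x, u) \<in> (adjacency U)\<^sup>*" if "u \<in> verts U" for u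
    proof (cases "u \<in> verts A")
      case True
      then show ?thesis using connected_graphD [OF conn(1) x(1)] adj by blast
    next
      case False
      then have "u \<in> verts B" using that by (simp add: U_def)
      then show ?thesis using connected_graphD [OF conn(2) x(2)] adj by blast
    qed
  qed
  moreover have "\<not> separable U"
  proof
    assume "separable U"
    then obtain H1 H2 v where s: "subgraph H1 U" "subgraph H2 U"
      and ne: "edges H1 \<noteq> {}" "edges H2 \<noteq> {}"
      and un: "edges H1 \<union> edges H2 = edges U" "edges H1 \<inter> edges H2 = {}"
      and v: "verts H1 \<union> verts H2 = verts U" "verts H1 \<inter> verts H2 = {v}"
      unfolding separable_def by blast
    have A: "edges A \<inter> edges H1 = {} \<or> edges A \<inter> edges H2 = {}"
      using nonseparable_within_separation [OF U(2) assms(3) s un v] .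
    have B: "edges B \<inter> edges H1 = {} \<or> edges B \<inter> edges H2 = {}"
      using nonseparable_within_separation [OF U(3) assms(4) s un v] .
    have "edges U = edges A \<union> edges B" by (simp add: U_def)
    then show False using A B e ne un by blast
  qed
  ultimately show ?thesis using U that by (simp add: nonseparable_def)
qed

lemma nonseparable_subset_block:
  assumes "finite_graph G" "subgraph A G" "nonseparable A"
  obtains B where "block B G" "subgraph A B"
proof -
  let ?P = "\<lambda>H. subgraph H G \<and> nonseparable H \<and> subgraph A H"
  \<comment> \<open>A proper extension has more vertices or more edges, so maximality of this size
    implies maximality with respect to inclusion.\<close>
  let ?f = "\<lambda>H. card (verts H) + card (edges H)"
  have fin: "finite (verts G)" "finite (edges G)"
    using assms(1) by (auto simp: finite_graph_def)
  have "?P A" using assms by (auto simp: subgraph_def)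
  moreover have "\<forall>H. ?P H \<longrightarrow> ?f H < Suc (?f G)"
    using fin by (auto simp: less_Suc_eq_le subgraph_def intro!: add_mono card_mono)
  ultimately have "\<exists>B. ?P B \<and> (\<forall>H. ?P H \<longrightarrow> ?f H \<le> ?f B)"
    by (rule ex_has_greatest_nat)
  then obtain B where B: "?P B" "\<And>H. ?P H \<Longrightarrow> ?f H \<le> ?f B"
    by blast
  have "H = B" if H: "subgraph H G" "nonseparable H" "subgraph B H" for H
  proof -
    have "?f H \<le> ?f B" using H B subgraph_trans by blast
    moreover have sub: "verts B \<subseteq> verts H" "edges B \<subseteq> edges H" "ends B = ends H"
      and finH: "finite (verts H)" "finite (edges H)"
      using H by (auto simp: subgraph_def finite_graph_def)
    moreover have "card (verts B) \<le> card (verts H)" "card (edges B) \<le> card (edges H)"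
      using sub finH by (auto intro: card_mono)
    ultimately have "verts B = verts H" "edges B = edges H"
      using card_seteq [of "verts H" "verts B"] card_seteq [of "edges H" "edges B"] by linarith+
    then show ?thesis using sub by (intro graph.equality) auto
  qed
  then have "block B G" using B by (auto simp: block_def)
  then show ?thesis using B that by blast
qed

lemma cactus_cycles_edge_disjoint:
  assumes "cactus G" "subgraph A G" "is_cycle A" "subgraph B G" "is_cycle B"
    and "edges A \<inter> edges B \<noteq> {}"
  shows "A = B"
proof -
  obtain e where "e \<in> edges A" "e \<in> edges B" using assms(6) by blast
  then obtain U where U: "subgraph U G" "nonseparable U" "subgraph A U" "subgraph B U"
    using nonseparable_union assms nonseparable_cycle by metis
  obtain K where K: "block K G" "subgraph U K"
    using nonseparable_subset_block U assms(1) unfolding cactus_def by metis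
  have A: "subgraph A K" and B: "subgraph B K" using U K subgraph_trans by blast+
  \<comment> \<open>A single edge with distinct ends contains no cycle: at the end \<open>u\<close>
    there would have to be a second edge or a loop.\<close>
  have "is_cycle K"
  proof (rule ccontr)
    assume "\<not> is_cycle K"
    then have "is_single_edge K" using assms(1) K(1) by (auto simp: cactus_def)
    then obtain d u v where K': "u \<noteq> v" "edges K = {d}" "ends K d = {u, v}"
      by (auto simp: is_single_edge_def)
    have d: "edges A = {d}" "ends A = ends K" "finite_graph A"
      using A K' cycle_edges_nonempty [OF assms(3)] by (auto simp: subgraph_def)
    then have "u \<in> verts A" using finite_graph_ends [of A d] K' by auto
    then show False
      using cycle_other_edge [OF assms(3), of u d] d K' by auto
  qed
  then show ?thesis using cycle_subgraph_cycle_eq A B assms by metis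
qed

section \<open>Bases of the cycle matroid\<close>

lemma cells_0_Cons:
  assumes "l \<in> cells (c # cs) 0"
  obtains e k where "l = (False, e) # k" "e \<in> insert (fst c) (snd c)" "k \<in> cells cs 0"
  using assms by auto

lemma cells_0_subset:
  "l \<in> cells cs 0 \<Longrightarrow> snd ` set l \<subseteq> (\<Union>c\<in>set cs. insert (fst c) (snd c))"
proof (induction cs arbitrary: l)
  case (Cons c cs)
  then obtain e k where l: "l = (False, e) # k" "e \<in> insert (fst c) (snd c)" "k \<in> cells cs 0"
    by (elim cells_0_Cons)
  then show ?case using Cons.IH [OF l(3)] by auto
qed simp

lemma separated_Cons_disjoint:
  "separated D (c # cs) \<Longrightarrow>
    insert (fst c) (snd c) \<inter> (\<Union>c\<in>set cs. insert (fst c) (snd c)) = {}"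
  by (auto simp: support_def)

text \<open>Disjointness keeps the edge chosen for one cycle out of all the others.\<close>

lemma cells_0_transversal:
  assumes "separated D cs" "l \<in> cells cs 0" "c \<in> set cs"
  shows "\<exists>e. snd ` set l \<inter> insert (fst c) (snd c) = {e}"
  using assms
proof (induction cs arbitrary: l)
  case (Cons b cs)
  then obtain e k where l: "l = (False, e) # k" "e \<in> insert (fst b) (snd b)" "k \<in> cells cs 0"
    by (elim cells_0_Cons)
  have disj: "insert (fst b) (snd b) \<inter> (\<Union>c\<in>set cs. insert (fst c) (snd c)) = {}"
    by (rule separated_Cons_disjoint [OF Cons.prems(1)])
  have set_l: "snd ` set l = insert e (snd ` set k)" using l by simp
  show ?case
  proof (cases "c \<in> set cs")
    case True
    then have "e \<notin> insert (fst c) (snd c)" using l disj by blast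
    then have "snd ` set l \<inter> insert (fst c) (snd c) = snd ` set k \<inter> insert (fst c) (snd c)"
      unfolding set_l by blast
    then show ?thesis using Cons.IH [OF _ l(3) True] Cons.prems(1) by simp
  next
    case False
    then have "c = b" using Cons.prems(3) by simp
    then have "snd ` set l \<inter> insert (fst c) (snd c) = {e}"
      unfolding set_l using l(2) cells_0_subset [OF l(3)] disj by blast
    then show ?thesis ..
  qed
qed simp

lemma finite_support: "separated D cs \<Longrightarrow> finite (support D cs)"
proof (induction cs)
  case (Cons c cs)
  then show ?case by (simp add: support_Cons)
qed (simp add: support_def)

text \<open>This matches the generators of the product ideal with the monomials of bases; disjoint
  supports let the products of the factors merge into one.\<close>

lemma cell_mon_eq_prod:
  assumes "separated D cs" "l \<in> cells cs 0"
  shows "(cell_mon D cs l :: ('e, 'k::field) mpoly) = (\<Prod>j\<in>support D cs - snd ` set l. indet j)"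
  using assms
proof (induction cs arbitrary: l)
  case Nil
  then show ?case by (simp add: support_def)
next
  case (Cons c cs)
  then obtain e k where l: "l = (False, e) # k" "e \<in> insert (fst c) (snd c)" "k \<in> cells cs 0"
    by (elim cells_0_Cons)
  have sep: "separated D cs" "finite (snd c)"
    and disj: "insert (fst c) (snd c) \<inter> support D cs = {}"
    using Cons.prems(1) by auto
  have "snd ` set k \<subseteq> support D cs"
    using cells_0_subset [OF l(3)] unfolding support_def by blast
  then have "support D (c # cs) - snd ` set l =
      (insert (fst c) (snd c) - {e}) \<union> (support D cs - snd ` set k)"
    unfolding support_Cons using l(1,2) disj by auto
  then have "(\<Prod>j\<in>support D (c # cs) - snd ` set l. indet j :: ('e, 'k) mpoly) =
      (\<Prod>j\<in>insert (fst c) (snd c) - {e}. indet j) * (\<Prod>j\<in>support D cs - snd ` set k. indet j)"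
    using sep finite_support [OF sep(1)] disj
    by (simp only:) (intro prod.union_disjoint; auto)
  also have "(\<Prod>j\<in>support D cs - snd ` set k. indet j :: ('e, 'k) mpoly) = cell_mon D cs k"
    by (rule Cons.IH [OF sep(1) l(3), symmetric])
  finally show ?case using l(1) by (simp only: cell_mon.simps snd_conv)
qed

lemma cells_0I:
  "(\<And>c. c \<in> set cs \<Longrightarrow> f c \<in> insert (fst c) (snd c)) \<Longrightarrow> map (\<lambda>c. (False, f c)) cs \<in> cells cs 0"
proof (induction cs)
  case (Cons c cs)
  then show ?case
    unfolding list.map cells_Cons_iff by (meson list.set_intros)
qed simp

text \<open>Putting a deleted edge back completes its cycle, so complements of cells are maximal.
  Conversely a basis misses an edge of every cycle; one missing edge for each gives a cell whose
  complement is independent and contains the basis, hence equals it.\<close>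

lemma matroid_basis_iff_cells:
  assumes sep: "separated D cs"
    and N: "\<And>X. indep N X \<longleftrightarrow>
      X \<subseteq> support D cs \<and> (\<forall>c\<in>set cs. \<not> insert (fst c) (snd c) \<subseteq> X)"
  shows "matroid_basis N B \<longleftrightarrow> (\<exists>l\<in>cells cs 0. B = support D cs - snd ` set l)"
proof
  have ind: "indep N (support D cs - snd ` set l)" if "l \<in> cells cs 0" for l
    unfolding N using cells_0_transversal [OF sep that] by blast
  show "matroid_basis N B" if ex: "\<exists>l\<in>cells cs 0. B = support D cs - snd ` set l"
  proof -
    obtain l where l: "l \<in> cells cs 0" "B = support D cs - snd ` set l"
      using ex by blast
    have "X = B" if X: "indep N X" "B \<subseteq> X" for X
    proof (rule ccontr)
      assume "X \<noteq> B"
      then obtain x where x: "x \<in> X" "x \<in> snd ` set l"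
        using X l N by blast
      then obtain c where c: "c \<in> set cs" "x \<in> insert (fst c) (snd c)"
        using cells_0_subset [OF l(1)] by blast
      obtain e where "snd ` set l \<inter> insert (fst c) (snd c) = {e}"
        using cells_0_transversal [OF sep l(1) c(1)] by blast
      moreover from this have "x = e" using c(2) x(2) by blast
      ultimately have "snd ` set l \<inter> insert (fst c) (snd c) = {x}" by simp
      moreover have "insert (fst c) (snd c) \<subseteq> support D cs"
        using c by (auto simp: support_def)
      ultimately have "insert (fst c) (snd c) - {x} \<subseteq> B"
        unfolding l(2) by blast
      then have "insert (fst c) (snd c) \<subseteq> X"
        using X(2) x(1) by blast
      then show False using X(1) c(1) unfolding N by blast
    qed
    then show ?thesis using ind l by (auto simp: matroid_basis_def)
  qed
  show "\<exists>l\<in>cells cs 0. B = support D cs - snd ` set l" if B: "matroid_basis N B"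
  proof -
    have "\<forall>c\<in>set cs. \<exists>x. x \<in> insert (fst c) (snd c) \<and> x \<notin> B" and sub: "B \<subseteq> support D cs"
      using B N by (auto simp: matroid_basis_def)
    then obtain f where f: "\<And>c. c \<in> set cs \<Longrightarrow> f c \<in> insert (fst c) (snd c)"
        "\<And>c. c \<in> set cs \<Longrightarrow> f c \<notin> B"
      by metis
    let ?l = "map (\<lambda>c. (False, f c)) cs"
    have l: "?l \<in> cells cs 0" using f(1) by (rule cells_0I)
    have "B \<subseteq> support D cs - snd ` set ?l" using sub f(2) by auto
    then have "B = support D cs - snd ` set ?l"
      using B ind [OF l] by (auto simp: matroid_basis_def)
    then show ?thesis using l by blast
  qed
qed

lemma separated_map:
  assumes "finite D" "distinct xs"
    and "\<And>i. i \<in> set xs \<Longrightarrow> finite (snd (c i)) \<and> fst (c i) \<notin> snd (c i) \<and>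
      insert (fst (c i)) (snd (c i)) \<inter> D = {}"
    and "\<And>i j. i \<in> set xs \<Longrightarrow> j \<in> set xs \<Longrightarrow> i \<noteq> j \<Longrightarrow>
      insert (fst (c i)) (snd (c i)) \<inter> insert (fst (c j)) (snd (c j)) = {}"
  shows "separated D (map c xs)"
  using assms
proof (induction xs)
  case (Cons x xs)
  have "insert (fst (c x)) (snd (c x)) \<inter> insert (fst (c j)) (snd (c j)) = {}" if "j \<in> set xs" for j
    using Cons.prems(2) that by (intro Cons.prems(4)) auto
  moreover have "insert (fst (c x)) (snd (c x)) \<inter> D = {}"
    using Cons.prems(3) [of x] by simp
  ultimately have "insert (fst (c x)) (snd (c x)) \<inter> support D (map c xs) = {}"
    unfolding support_def set_map by blast
  moreover have "separated D (map c xs)"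
    by (rule Cons.IH) (use Cons.prems in auto)
  ultimately show ?case using Cons.prems(3) [of x] by simp
qed simp

theorem theorem2:
  fixes G :: "('v, 'e) graph" and C :: "nat \<Rightarrow> ('v, 'e) graph" and n :: "nat \<Rightarrow> nat" and t :: nat
  assumes "cactus G"
    and "t \<ge> 1"
    and "bij_betw C {1..t} {H. subgraph H G \<and> is_cycle H}"
    and "\<And>i. i \<in> {1..t} \<Longrightarrow> cycle_of_length (n i) (C i)"
  shows "\<exists>\<beta> \<epsilon> d.
    (\<forall>i\<le>t. int (\<beta> i) = (\<Sum>j=0..i. (- 1) ^ j * int ((t - j) choose (i - j)) * int (elem_sym n t (t - j)))) \<and>
    (\<forall>i>t. \<beta> i = 0) \<and>
    minimal_free_resolution (edges G)
      (facet_ideal (cycle_matroid G) :: ('e, 'k::field) mpoly set) \<beta> \<epsilon> d"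
proof -
  have C: "subgraph (C i) G" "is_cycle (C i)" if "i \<in> {1..t}" for i
    using bij_betwE [OF assms(3)] that by auto
  have cycles: "\<exists>i\<in>{1..t}. H = C i" if "subgraph H G" "is_cycle H" for H
    using bij_betw_imp_surj_on [OF assms(3)] that by (metis (mono_tags, lifting) imageE mem_Collect_eq)
  have disj: "edges (C i) \<inter> edges (C j) = {}" if "i \<in> {1..t}" "j \<in> {1..t}" "i \<noteq> j" for i j
  proof (rule ccontr)
    assume "edges (C i) \<inter> edges (C j) \<noteq> {}"
    then have "C i = C j"
      using cactus_cycles_edge_disjoint [OF assms(1)] C that by blast
    then show False
      using inj_onD [OF bij_betw_imp_inj_on [OF assms(3)]] that by blast
  qed
  have fin: "finite (edges G)"
    using assms(1) by (simp add: cactus_def finite_graph_def)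
  have finC: "finite (edges (C i))" and subC: "edges (C i) \<subseteq> edges G" if "i \<in> {1..t}" for i
    using C(1) [OF that] by (auto simp: subgraph_def finite_graph_def)
  have cardC: "card (edges (C i)) = n i" if "i \<in> {1..t}" for i
    using assms(4) [OF that] by (auto simp: cycle_of_length_def distinct_card)
  \<comment> \<open>Any edge of the cycle may serve as the one with which the syzygies compare the
    others.\<close>
  define z where "z i = (SOME e. e \<in> edges (C i))" for i
  define c where "c i = (z i, edges (C i) - {z i})" for i
  have z: "z i \<in> edges (C i)" if "i \<in> {1..t}" for i
    unfolding z_def using cycle_edges_nonempty [OF C(2) [OF that]] by (simp add: some_in_eq)
  have c: "insert (fst (c i)) (snd (c i)) = edges (C i)" if "i \<in> {1..t}" for i
    using z [OF that] by (auto simp: c_def)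
  \<comment> \<open>The edges on no cycle; they contribute the monomial factor common to all
    generators.\<close>
  define D where "D = edges G - (\<Union>i\<in>{1..t}. edges (C i))"
  define cs where "cs = map c [1..<Suc t]"
  have set_cs: "set cs = c ` {1..t}"
    by (simp add: cs_def atLeastLessThanSuc_atLeastAtMost del: upt_Suc)
  have sep: "separated D cs"
    unfolding cs_def
  proof (rule separated_map)
    show "finite D" using fin by (simp add: D_def)
  next
    fix i assume "i \<in> set [1..<Suc t]"
    then have i: "i \<in> {1..t}" by auto
    then show "finite (snd (c i)) \<and> fst (c i) \<notin> snd (c i) \<and>
        insert (fst (c i)) (snd (c i)) \<inter> D = {}"
      unfolding c [OF i] using finC by (auto simp: D_def c_def)
  next
    fix i j assume "i \<in> set [1..<Suc t]" "j \<in> set [1..<Suc t]" and ij: "i \<noteq> j"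
    then have "i \<in> {1..t}" "j \<in> {1..t}" by auto
    then show "insert (fst (c i)) (snd (c i)) \<inter> insert (fst (c j)) (snd (c j)) = {}"
      using disj ij by (simp only: c) simp
  qed simp
  have supp: "support D cs = edges G"
  proof -
    have "(\<Union>b\<in>set cs. insert (fst b) (snd b)) = (\<Union>i\<in>{1..t}. edges (C i))"
      unfolding set_cs using c by (simp add: image_image)
    moreover have "(\<Union>i\<in>{1..t}. edges (C i)) \<subseteq> edges G" using subC by blast
    ultimately show ?thesis unfolding support_def D_def by (simp only:) blast
  qed
  have "indep (cycle_matroid G) X \<longleftrightarrow>
      X \<subseteq> support D cs \<and> (\<forall>b\<in>set cs. \<not> insert (fst b) (snd b) \<subseteq> X)" for X
  proof -
    \<comment> \<open>The \<open>C i\<close> are all the cycles of \<open>G\<close>, so containing a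
      cycle means containing the edges of some pair in \<open>cs\<close>.\<close>
    have "(\<exists>H. subgraph H G \<and> is_cycle H \<and> edges H \<subseteq> X) \<longleftrightarrow> (\<exists>i\<in>{1..t}. edges (C i) \<subseteq> X)"
      using C cycles by blast
    also have "\<dots> \<longleftrightarrow> (\<exists>b\<in>set cs. insert (fst b) (snd b) \<subseteq> X)"
      unfolding set_cs using c by (metis (no_types, lifting) imageE imageI)
    finally show ?thesis by (auto simp: cycle_matroid_def supp)
  qed
  then have basis: "matroid_basis (cycle_matroid G) B \<longleftrightarrow>
      (\<exists>l\<in>cells cs 0. B = support D cs - snd ` set l)" for B
    by (rule matroid_basis_iff_cells [OF sep])
  have "{\<Prod>j\<in>B. indet j |B. matroid_basis (cycle_matroid G) B} =
      (cell_mon D cs ` cells cs 0 :: ('e, 'k) mpoly set)"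
    unfolding basis using cell_mon_eq_prod [OF sep] by (auto simp: image_iff)
  then have ideal: "facet_ideal (cycle_matroid G) =
      (Idl\<^bsub>poly_ring (edges G)\<^esub> (cell_mon D cs ` cells cs 0) :: ('e, 'k) mpoly set)"
    by (simp add: facet_ideal_def cycle_matroid_def)
  obtain \<epsilon> d where res: "minimal_free_resolution (edges G)
      (facet_ideal (cycle_matroid G) :: ('e, 'k) mpoly set) (\<lambda>i. card (cells cs i)) \<epsilon> d"
    unfolding ideal using minimal_free_resolution_cell_ideal [OF sep, of "edges G"] supp by blast
  have betti: "int (card (cells cs i)) =
      (\<Sum>j=0..i. (- 1) ^ j * int ((t - j) choose (i - j)) * int (elem_sym n t (t - j)))"
    if "i \<le> t" for i
  proof -
    let ?p = "\<lambda>b. [:int (card (insert (fst b) (snd b))), int (card (snd b)):]"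
    have "?p (c k) = [:int (n k), int (n k) - 1:]" if "k \<in> {1..t}" for k
    proof -
      have "card (snd (c k)) = n k - 1" "n k \<ge> 1"
        using z [OF that] finC [OF that] cardC [OF that] assms(4) [OF that]
        by (auto simp: c_def cycle_of_length_def)
      then show ?thesis using cardC [OF that] by (simp add: c [OF that] of_nat_diff)
    qed
    then have "(\<Prod>b\<leftarrow>cs. ?p b) = (\<Prod>k\<in>{1..t}. [:int (n k), int (n k) - 1:])"
      unfolding cs_def map_map o_def
      by (subst prod.distinct_set_conv_list [symmetric])
        (auto simp: atLeastLessThanSuc_atLeastAtMost simp del: upt_Suc intro!: prod.cong)
    then show ?thesis
      using card_cells [OF sep, of i] coeff_prod_elem_sym [OF that, of n] by simp
  qed
  \<comment> \<open>The list \<open>cs\<close> has one entry for each of the \<open>t\<close>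
    cycles.\<close>
  have "card (cells cs i) = 0" if "i > t" for i
    using that by (simp add: cells_eq_empty cs_def)
  with res betti show ?thesis
    by (intro exI [of _ "\<lambda>i. card (cells cs i)"] exI [of _ \<epsilon>] exI [of _ d]) simp
qed

end
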